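(* For each $\vec e\in\{\vec0,\vec\infty\}$, the $L_{\mathcal{O}}$-theory $T(\vec0,\vec e)$ has the VC $1$ property.
   Context: An oriented abelian group is an abelian group $(A,+,-,0)$ with a ternary relation $\mathcal{O}$ which is a translation-invariant cyclic order: for all $a,b,c,d$, $\mathcal{O}(a,b,c)\to\mathcal{O}(b,c,a)$; $\mathcal{O}(a,b,c)\to\neg\mathcal{O}(c,b,a)$; $\mathcal{O}(a,b,c)\wedge\mathcal{O}(a,c,d)\to\mathcal{O}(a,b,d)$; for pairwise distinct $a,b,c$, $\mathcal{O}(a,b,c)\vee\mathcal{O}(c,b,a)$; $\mathcal{O}(a,b,c)\to\mathcal{O}(a+d,b+d,c+d)$. Write $x<_0y$ for $x\neq y\wedge\mathcal{O}(0,x,y)$. $A$ is regularly dense if for each prime $p$ and all $a,b$ with $\mathcal{O}(0,a,b)$ there is $c$ with $\mathcal{O}(a,pc,b)$ and $ic<_0(i+1)c$ for $i=1,\dots,p-1$. For a prime $p$, $[p]A=|A/pA|$, $\operatorname{Tor}_n(A)=\{a:na=0\}$, and $e(A,p)$ is the least $e\in\mathbb{N}$ with $\operatorname{Tor}_{p^{e+k}}(A)=\operatorname{Tor}_{p^e}(A)$ for all $k$ (where $\operatorname{Tor}_{p^0}(A)=\{0\}$), or $\infty$ if none exists. For sequences $\vec d,\vec e$ indexed by primes $p_i$ with values in $\mathbb{N}\cup\{\infty\}$, $T(\vec d,\vec e)$ is the theory in $L_{\mathcal{O}}=\{+,-,0,\mathcal{O}\}$ whose models are regularly dense oriented abelian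 groups with $[p_i]A=p_i^{d_i}$ and $e(A,p_i)=e_i$; $\vec0,\vec\infty$ are constant sequences. UDTFS: a finite set $\Delta(x;\vec y)$ of formulas in a single object variable $x$ and parameter variables $\vec y$ has uniform definability of types over finite sets (UDTFS) with $d$ parameters in a model $M$ if there are finitely many families $(\psi^i_\varphi(\vec y;\vec y_1,\dots,\vec y_d))_{\varphi\in\Delta}$, $i\in I$, of formulas such that for every finite $B\subseteq M^{|\vec y|}$ with $|B|\ge2$ and every complete $\Delta$-type $q$ in $x$ over $B$ there are $\vec b_1,\dots,\vec b_d\in B$ and $i\in I$ with: for all $\varphi\in\Delta$ and $\vec b\in B$, $\varphi(x;\vec b)\in q$ iff $M\models\psi^i_\varphi(\vec b;\vec b_1,\dots,\vec b_d)$. A complete theory has the VC $d$ property if every finite set of partitioned formulas in a single object variable has UDTFS with $d$ parameters. *)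

theory Defs
  imports Complex_Main "HOL-Computational_Algebra.Primes" "HOL-Library.Extended_Nat"
begin

(* The universe of a structure is the whole type 'a. *)
record 'a ostruct =
  oadd :: "'a \<Rightarrow> 'a \<Rightarrow> 'a"
  oneg :: "'a \<Rightarrow> 'a"
  ozero :: 'a
  ocyc :: "'a \<Rightarrow> 'a \<Rightarrow> 'a \<Rightarrow> bool"

datatype oterm =
    Var nat
  | Zero
  | Add oterm oterm
  | Minus oterm

datatype oform =
    Eq oterm oterm
  | Cyc oterm oterm oterm
  | Neg oform
  | Conj oform oform
  | Exi nat oform

primrec tval :: "'a ostruct \<Rightarrow> (nat \<Rightarrow> 'a) \<Rightarrow> oterm \<Rightarrow> 'a" where
  "tval M v (Var n) = v n"
| "tval M v Zero = ozero M"
| "tval M v (Add s t) = oadd M (tval M v s) (tval M v t)"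
| "tval M v (Minus t) = oneg M (tval M v t)"

primrec sat :: "'a ostruct \<Rightarrow> (nat \<Rightarrow> 'a) \<Rightarrow> oform \<Rightarrow> bool" where
  "sat M v (Eq s t) \<longleftrightarrow> tval M v s = tval M v t"
| "sat M v (Cyc r s t) \<longleftrightarrow> ocyc M (tval M v r) (tval M v s) (tval M v t)"
| "sat M v (Neg f) \<longleftrightarrow> \<not> sat M v f"
| "sat M v (Conj f g) \<longleftrightarrow> sat M v f \<and> sat M v g"
| "sat M v (Exi n f) \<longleftrightarrow> (\<exists>a. sat M (v(n := a)) f)"

primrec tvars :: "oterm \<Rightarrow> nat set" where
  "tvars (Var n) = {n}"
| "tvars Zero = {}"
| "tvars (Add s t) = tvars s \<union> tvars t"
| "tvars (Minus t) = tvars t"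

primrec fvars :: "oform \<Rightarrow> nat set" where
  "fvars (Eq s t) = tvars s \<union> tvars t"
| "fvars (Cyc r s t) = tvars r \<union> tvars s \<union> tvars t"
| "fvars (Neg f) = fvars f"
| "fvars (Conj f g) = fvars f \<union> fvars g"
| "fvars (Exi n f) = fvars f - {n}"

(* For a formula whose free variables are among 0, ..., length xs - 1, variable number i
   is interpreted by the i-th entry of xs (the values at other variables are irrelevant). *)
definition sat_list :: "'a ostruct \<Rightarrow> oform \<Rightarrow> 'a list \<Rightarrow> bool" where
  "sat_list M f xs \<longleftrightarrow> sat M (\<lambda>i. xs ! i) f"

definition omult :: "'a ostruct \<Rightarrow> nat \<Rightarrow> 'a \<Rightarrow> 'a" where
  "omult M n a = (oadd M a ^^ n) (ozero M)"

definition oriented_abelian_group :: "'a ostruct \<Rightarrow> bool" where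
  "oriented_abelian_group M \<longleftrightarrow>
     class.ab_group_add (oadd M) (ozero M) (\<lambda>a b. oadd M a (oneg M b)) (oneg M) \<and>
     (\<forall>a b c. ocyc M a b c \<longrightarrow> ocyc M b c a) \<and>
     (\<forall>a b c. ocyc M a b c \<longrightarrow> \<not> ocyc M c b a) \<and>
     (\<forall>a b c d. ocyc M a b c \<and> ocyc M a c d \<longrightarrow> ocyc M a b d) \<and>
     (\<forall>a b c. a \<noteq> b \<and> b \<noteq> c \<and> a \<noteq> c \<longrightarrow> ocyc M a b c \<or> ocyc M c b a) \<and>
     (\<forall>a b c d. ocyc M a b c \<longrightarrow> ocyc M (oadd M a d) (oadd M b d) (oadd M c d))"

definition less0 :: "'a ostruct \<Rightarrow> 'a \<Rightarrow> 'a \<Rightarrow> bool" where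
  "less0 M x y \<longleftrightarrow> x \<noteq> y \<and> ocyc M (ozero M) x y"

definition regularly_dense :: "'a ostruct \<Rightarrow> bool" where
  "regularly_dense M \<longleftrightarrow>
     (\<forall>p a b. prime p \<and> ocyc M (ozero M) a b \<longrightarrow>
        (\<exists>c. ocyc M a (omult M p c) b \<and>
             (\<forall>i\<in>{1..p - 1}. less0 M (omult M i c) (omult M (i + 1) c))))"

definition cosets_mult :: "'a ostruct \<Rightarrow> nat \<Rightarrow> 'a set set" where
  "cosets_mult M p = (\<lambda>a. oadd M a ` range (omult M p)) ` UNIV"

(* [p]A = p^d, where p^\<infinity> = \<infinity> *)
definition index_is_power :: "'a ostruct \<Rightarrow> nat \<Rightarrow> enat \<Rightarrow> bool" where
  "index_is_power M p d \<longleftrightarrow>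
     (case d of enat k \<Rightarrow> finite (cosets_mult M p) \<and> card (cosets_mult M p) = p ^ k
              | \<infinity> \<Rightarrow> infinite (cosets_mult M p))"

definition Tor :: "'a ostruct \<Rightarrow> nat \<Rightarrow> 'a set" where
  "Tor M n = {a. omult M n a = ozero M}"

definition tor_exponent :: "'a ostruct \<Rightarrow> nat \<Rightarrow> enat" where
  "tor_exponent M p =
     (if \<exists>e. \<forall>k. Tor M (p ^ (e + k)) = Tor M (p ^ e)
      then enat (LEAST e. \<forall>k. Tor M (p ^ (e + k)) = Tor M (p ^ e))
      else \<infinity>)"

(* The theory T(d, e), given by its models with universe 'a; the sequences d and e are
   functions of which only the values at primes matter. *)
definition T_models :: "(nat \<Rightarrow> enat) \<Rightarrow> (nat \<Rightarrow> enat) \<Rightarrow> 'a ostruct set" where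
  "T_models d e =
     {M. oriented_abelian_group M \<and> regularly_dense M \<and>
         (\<forall>p. prime p \<longrightarrow> index_is_power M p (d p) \<and> tor_exponent M p = e p)}"

(* Partitioned formulas phi(x; y) with |y| = m: the object variable x is variable 0, and the
   parameter variables y are the variables 1, ..., m. *)
definition partitioned :: "nat \<Rightarrow> oform \<Rightarrow> bool" where
  "partitioned m f \<longleftrightarrow> fvars f \<subseteq> {..<1 + m}"

(* Complete Delta-types in x over B, as sets of signed instances: (f, b, True) stands for
   f(x; b) and (f, b, False) for its negation.  Consistency with the theory of M with names
   for its elements is finite satisfiability in M. *)
definition complete_type ::
  "'a ostruct \<Rightarrow> oform set \<Rightarrow> 'a list set \<Rightarrow> (oform \<times> 'a list \<times> bool) set \<Rightarrow> bool" where
  "complete_type M \<Delta> B q \<longleftrightarrow>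
     q \<subseteq> \<Delta> \<times> B \<times> UNIV \<and>
     (\<forall>f\<in>\<Delta>. \<forall>b\<in>B. (f, b, True) \<in> q \<or> (f, b, False) \<in> q) \<and>
     (\<forall>q0. q0 \<subseteq> q \<and> finite q0 \<longrightarrow>
        (\<exists>a. \<forall>(f, b, s)\<in>q0. sat_list M f (a # b) \<longleftrightarrow> s))"

(* The formulas psi i f(y; y_1, ..., y_d) (i in I, f in Delta) uniformly define Delta-types
   over finite sets in M; each of y, y_1, ..., y_d is a block of m variables, in this order. *)
definition defines_types ::
  "'a ostruct \<Rightarrow> nat \<Rightarrow> nat \<Rightarrow> oform set \<Rightarrow> nat set \<Rightarrow> (nat \<Rightarrow> oform \<Rightarrow> oform) \<Rightarrow> bool" where
  "defines_types M m d \<Delta> I \<psi> \<longleftrightarrow>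
     (\<forall>B q. finite B \<and> (\<forall>b\<in>B. length b = m) \<and> card B \<ge> 2 \<and> complete_type M \<Delta> B q \<longrightarrow>
        (\<exists>bs i. length bs = d \<and> set bs \<subseteq> B \<and> i \<in> I \<and>
           (\<forall>f\<in>\<Delta>. \<forall>b\<in>B. (f, b, True) \<in> q \<longleftrightarrow> sat_list M (\<psi> i f) (b @ concat bs))))"

(* UDTFS with d parameters, with one choice of defining formulas that works in every M in K;
   K = {M} gives the notion for a single structure M. *)
definition has_UDTFS :: "'a ostruct set \<Rightarrow> nat \<Rightarrow> nat \<Rightarrow> oform set \<Rightarrow> bool" where
  "has_UDTFS K m d \<Delta> \<longleftrightarrow>
     (\<exists>I \<psi>. finite I \<and> (\<forall>i\<in>I. \<forall>f\<in>\<Delta>. fvars (\<psi> i f) \<subseteq> {..<m + d * m}) \<and>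
        (\<forall>M\<in>K. defines_types M m d \<Delta> I \<psi>))"

(* The VC d property of the theory with class of models K.  For a complete theory the defining
   formulas found in one model work in all of them, so the uniformity in M is no restriction. *)
definition has_VC_property :: "'a ostruct set \<Rightarrow> nat \<Rightarrow> bool" where
  "has_VC_property K d \<longleftrightarrow>
     (\<forall>m \<Delta>. finite \<Delta> \<and> (\<forall>f\<in>\<Delta>. partitioned m f) \<longrightarrow> has_UDTFS K m d \<Delta>)"

end

theory Submission
  imports Defs
begin

text \<open>A cyclically ordered group \<open>A\<close> is \<open>U / \<int>z\<close> for a linearly ordered group \<open>U\<close> with a cofinal
  element \<open>z > 0\<close>; take \<open>U = \<int> \<times> A\<close> with carries and lift \<open>A\<close> to the interval \<open>[0, z)\<close>. Regular density of
  \<open>A\<close> says that the multiples of every \<open>n\<close> are dense in \<open>U\<close>, and divisibility of \<open>A\<close> that every class of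
  \<open>U\<close> modulo \<open>nU\<close> contains a multiple of \<open>z\<close>. A back-and-forth argument shows that the truth of a formula
  depends only on the order of bounded sums of the lifted variables and \<open>z\<close>, and on the classes of the lifts
  modulo some \<open>RU\<close>. A formula in one object variable \<open>x\<close> is thus decided by the class of \<open>x\<close> and by its position among
  finitely many cuts over the parameters, so a type over a finite set \<open>B\<close> is determined by the class of a
  realization and the largest cut below it, which comes from a single parameter in \<open>B\<close>.\<close>

section \<open>Sums in linearly ordered groups\<close>

text \<open>Bounded sums involving \<open>x\<close> would produce cuts for \<open>k * x\<close> with
  many coefficients \<open>k\<close>. With \<open>L = fact N\<close> every comparison can be scaled
  until \<open>x\<close> has the coefficient \<open>L\<close>. All cuts then constrain the single
  element \<open>L * x\<close> and are linearly ordered, so one largest cut, hence one parameter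
  tuple, suffices. The price is a factor \<open>L\<close> in the lengths and in the modulus: if
  \<open>L * x\<close> equals a difference of sums, the copy of that difference must be divisible by
  \<open>L\<close> with a quotient in the right class modulo \<open>R\<close>, so agreement modulo
  \<open>L * R\<close> is required before a quantifier. A type is defined as a germ: it contains
  \<open>f(x; b)\<close> exactly when \<open>f\<close> holds at all elements of the right class that
  lie on the proper side of the cut and close enough to it. No formula has to name the next cut
  above \<open>x\<close>, which could come from a second tuple.\<close>

context linordered_ab_group_add
begin

primrec nmul :: "nat \<Rightarrow> 'a \<Rightarrow> 'a" where
  "nmul 0 x = 0"
| "nmul (Suc n) x = x + nmul n x"

lemma nmul_zero [simp]: "nmul n 0 = 0"
  by (induction n) auto

lemma nmul_add_left: "nmul (m + n) x = nmul m x + nmul n x"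
  by (induction m) (auto simp: add.assoc)

lemma nmul_add_right: "nmul n (x + y) = nmul n x + nmul n y"
  by (induction n) (auto simp: ac_simps)

lemma nmul_minus: "nmul n (- x) = - nmul n x"
  by (induction n) auto

lemma nmul_diff: "nmul n (x - y) = nmul n x - nmul n y"
  using nmul_add_right[of n x "- y"] by (simp add: nmul_minus)

lemma nmul_nmul: "nmul m (nmul n x) = nmul (m * n) x"
  by (induction m) (auto simp: nmul_add_left)

lemma nmul_strict_mono: "0 < n \<Longrightarrow> x < y \<Longrightarrow> nmul n x < nmul n y"
proof (induction n)
  case (Suc n)
  then show ?case
    using add_strict_mono[of x y "nmul n x" "nmul n y"] by (cases n) simp_all
qed auto

lemma nmul_less_iff: "0 < n \<Longrightarrow> nmul n x < nmul n y \<longleftrightarrow> x < y"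
  using nmul_strict_mono[of n x y] nmul_strict_mono[of n y x] less_linear[of x y]
  by (auto dest: less_asym)

text \<open>Lists with repetition encode combinations with natural coefficients, bounded by the
  length; negative coefficients are avoided by comparing two sums.\<close>

definition lsum :: "('i \<Rightarrow> 'a) \<Rightarrow> 'i list \<Rightarrow> 'a" where
  "lsum V ps = sum_list (map V ps)"

lemma lsum_simps [simp]:
  "lsum V [] = 0" "lsum V (i # ps) = V i + lsum V ps"
  "lsum V (ps @ qs) = lsum V ps + lsum V qs"
  by (simp_all add: lsum_def)

lemma lsum_replicate [simp]: "lsum V (replicate n i) = nmul n (V i)"
  by (induction n) auto

lemma lsum_concat_replicate [simp]: "lsum V (concat (replicate n ps)) = nmul n (lsum V ps)"
  by (induction n) auto

lemma lsum_cong: "(\<And>i. i \<in> set ps \<Longrightarrow> V i = W i) \<Longrightarrow> lsum V ps = lsum W ps"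
  by (induction ps) auto

lemma lsum_split: "lsum V ps = nmul (count_list ps x) (V x) + lsum V (filter (\<lambda>i. i \<noteq> x) ps)"
  by (induction ps) (auto simp: ac_simps)

section \<open>Agreement of two assignments and its extension by one point\<close>

definition agree :: "nat \<Rightarrow> nat \<Rightarrow> 'i set \<Rightarrow> ('i \<Rightarrow> 'a) \<Rightarrow> ('i \<Rightarrow> 'a) \<Rightarrow> bool" where
  "agree N R S V W \<longleftrightarrow>
     (\<forall>ps qs. set ps \<subseteq> S \<and> set qs \<subseteq> S \<and> length ps \<le> N \<and> length qs \<le> N \<longrightarrow>
        (lsum V ps < lsum V qs \<longleftrightarrow> lsum W ps < lsum W qs)) \<and>
     (\<forall>i\<in>S. \<exists>c. W i = V i + nmul R c)"

lemma agree_less: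
  "agree N R S V W \<Longrightarrow> set ps \<subseteq> S \<Longrightarrow> set qs \<subseteq> S \<Longrightarrow> length ps \<le> N \<Longrightarrow> length qs \<le> N \<Longrightarrow>
     lsum V ps < lsum V qs \<longleftrightarrow> lsum W ps < lsum W qs"
  unfolding agree_def by blast

lemma agree_eq:
  "agree N R S V W \<Longrightarrow> set ps \<subseteq> S \<Longrightarrow> set qs \<subseteq> S \<Longrightarrow> length ps \<le> N \<Longrightarrow> length qs \<le> N \<Longrightarrow>
     lsum V ps = lsum V qs \<longleftrightarrow> lsum W ps = lsum W qs"
  using agree_less[of N R S V W ps qs] agree_less[of N R S V W qs ps]
    less_linear[of "lsum V ps" "lsum V qs"] less_linear[of "lsum W ps" "lsum W qs"]
  by auto

lemma agree_residue: "agree N R S V W \<Longrightarrow> i \<in> S \<Longrightarrow> \<exists>c. W i = V i + nmul R c"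
  unfolding agree_def by blast

lemma agree_mono:
  assumes "agree N R S V W" "N' \<le> N" "R' dvd R" "S' \<subseteq> S"
  shows "agree N' R' S' V W"
proof -
  have "\<exists>c. W i = V i + nmul R' c" if i: "i \<in> S'" for i
  proof -
    obtain c where "W i = V i + nmul R c"
      using agree_residue[OF assms(1) subsetD[OF assms(4) i]] by blast
    moreover obtain k where "R = R' * k" using assms(3) by blast
    ultimately show ?thesis by (metis nmul_nmul)
  qed
  moreover have "lsum V ps < lsum V qs \<longleftrightarrow> lsum W ps < lsum W qs"
    if "set ps \<subseteq> S'" "set qs \<subseteq> S'" "length ps \<le> N'" "length qs \<le> N'" for ps qs
    using agree_less[OF assms(1), of ps qs] that assms by auto
  ultimately show ?thesis unfolding agree_def by blast
qed

lemma agree_sym: "agree N R S V W \<Longrightarrow> agree N R S W V"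
  unfolding agree_def
  by (metis (no_types) add_diff_cancel_right' diff_conv_add_uminus nmul_minus)

text \<open>Cancelling the common copies of \<open>x\<close> leaves \<open>d\<close> of them on one
  side with \<open>1 \<le> d \<le> N\<close>, so \<open>d\<close> divides \<open>L\<close>.
  Multiplication by \<open>c = L / d\<close> preserves the inequality and makes the coefficient of
  \<open>x\<close> equal to \<open>L\<close>. The factor depends on the lists alone and therefore
  serves all assignments \<open>V\<close>.\<close>

lemma lsum_less_normalize:
  assumes "\<forall>k\<in>{1..N}. k dvd L" "L > 0" "length ps \<le> N" "count_list qs x < count_list ps x"
  obtains c where "c > 0" "c \<le> L"
    "\<And>V. lsum V ps < lsum V qs \<longleftrightarrow>
       nmul L (V x) + lsum V (concat (replicate c (filter (\<lambda>i. i \<noteq> x) ps)))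
         < lsum V (concat (replicate c (filter (\<lambda>i. i \<noteq> x) qs)))"
    "\<And>V. lsum V qs < lsum V ps \<longleftrightarrow>
       lsum V (concat (replicate c (filter (\<lambda>i. i \<noteq> x) qs)))
         < nmul L (V x) + lsum V (concat (replicate c (filter (\<lambda>i. i \<noteq> x) ps)))"
proof -
  define d where "d = count_list ps x - count_list qs x"
  have "d \<in> {1..N}"
    using assms(3,4) count_le_length[of ps x] by (auto simp: d_def)
  then obtain c where c: "L = d * c" using assms(1) by blast
  have c0: "c > 0" "c \<le> L" "d > 0" using c assms(2) by auto
  let ?f = "filter (\<lambda>i. i \<noteq> x)"
  have P: "lsum V ps = nmul (count_list qs x) (V x) + (nmul d (V x) + lsum V (?f ps))" for V
    using assms(4) lsum_split[of V ps x]
    by (simp add: d_def nmul_add_left[symmetric] add.assoc[symmetric])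
  have Q: "lsum V qs = nmul (count_list qs x) (V x) + lsum V (?f qs)" for V
    by (rule lsum_split)
  have S: "nmul L (V x) + lsum V (concat (replicate c (?f ps)))
       = nmul c (nmul d (V x) + lsum V (?f ps))" for V
    by (simp add: nmul_add_right nmul_nmul c mult.commute)
  show ?thesis
    by (rule that[OF c0(1,2)])
      (unfold S, unfold lsum_concat_replicate nmul_less_iff[OF c0(1)] P Q, simp_all)
qed

text \<open>By normalization only comparisons with exactly \<open>L\<close> copies of
  \<open>x\<close> on one side remain to be checked; \<open>L * N\<close> bounds the lists after
  they have been repeated \<open>c \<le> L\<close> times.\<close>

lemma agree_insertI:
  assumes L: "\<forall>k\<in>{1..N}. k dvd L" "L > 0"
    and ag: "agree N R S V W"
    and less: "\<And>ps qs. set ps \<subseteq> S \<Longrightarrow> set qs \<subseteq> S \<Longrightarrow> length ps \<le> L * N \<Longrightarrow> length qs \<le> L * N \<Longrightarrow>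
          nmul L (V x) + lsum V ps < lsum V qs \<longleftrightarrow> nmul L (W x) + lsum W ps < lsum W qs"
    and greater: "\<And>ps qs. set ps \<subseteq> S \<Longrightarrow> set qs \<subseteq> S \<Longrightarrow> length ps \<le> L * N \<Longrightarrow> length qs \<le> L * N \<Longrightarrow>
          lsum V qs < nmul L (V x) + lsum V ps \<longleftrightarrow> lsum W qs < nmul L (W x) + lsum W ps"
    and res: "W x = V x + nmul R c"
  shows "agree N R (insert x S) V W"
  unfolding agree_def
proof (intro conjI allI impI)
  show "\<forall>i\<in>insert x S. \<exists>c. W i = V i + nmul R c"
    using res agree_residue[OF ag] by auto
next
  fix ps qs :: "'b list"
  assume A: "set ps \<subseteq> insert x S \<and> set qs \<subseteq> insert x S \<and> length ps \<le> N \<and> length qs \<le> N"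
  let ?f = "filter (\<lambda>i. i \<noteq> x)"
  have sub: "set (?f ps) \<subseteq> S" "set (?f qs) \<subseteq> S" using A by auto
  have len: "length (?f ps) \<le> N" "length (?f qs) \<le> N"
    using A by (auto intro: le_trans[OF length_filter_le])
  have sub': "set (concat (replicate c (?f ps))) \<subseteq> S" "set (concat (replicate c (?f qs))) \<subseteq> S" for c
    using sub by (auto simp: set_replicate_conv_if)
  have len': "length (concat (replicate c (?f ps))) \<le> L * N"
    "length (concat (replicate c (?f qs))) \<le> L * N" if "c \<le> L" for c
    using len that by (auto simp: length_concat sum_list_replicate intro: mult_le_mono)
  consider "count_list qs x = count_list ps x" | "count_list qs x < count_list ps x"
    | "count_list ps x < count_list qs x" by linarith
  then show "lsum V ps < lsum V qs \<longleftrightarrow> lsum W ps < lsum W qs"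
  proof cases
    case 1
    then show ?thesis
      using agree_less[OF ag sub len] lsum_split[of V ps x] lsum_split[of V qs x]
        lsum_split[of W ps x] lsum_split[of W qs x] by simp
  next
    case 2
    obtain c where c: "c \<le> L"
      "\<And>V. lsum V ps < lsum V qs \<longleftrightarrow>
        nmul L (V x) + lsum V (concat (replicate c (?f ps))) < lsum V (concat (replicate c (?f qs)))"
      using lsum_less_normalize[OF L _ 2] A by metis
    show ?thesis
      unfolding c(2) by (rule less[OF sub' len'[OF c(1)]])
  next
    case 3
    obtain c where c: "c \<le> L"
      "\<And>V. lsum V ps < lsum V qs \<longleftrightarrow>
        lsum V (concat (replicate c (?f ps))) < nmul L (V x) + lsum V (concat (replicate c (?f qs)))"
      using lsum_less_normalize[OF L _ 3] A by metis
    show ?thesis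
      unfolding c(2) by (rule greater[OF sub'(2,1) len'(2,1)[OF c(1)]])
  qed
qed

lemma finite_ex_max:
  fixes g :: "'b \<Rightarrow> 'a"
  assumes "finite F" "F \<noteq> {}"
  shows "\<exists>p\<in>F. \<forall>q\<in>F. g q \<le> g p"
proof -
  have "Max (g ` F) \<in> g ` F" using assms by (intro Max_in) auto
  then obtain p where "p \<in> F" "Max (g ` F) = g p" by blast
  moreover have "g q \<le> Max (g ` F)" if "q \<in> F" for q using assms that by (intro Max_ge) auto
  ultimately show ?thesis by auto
qed

lemma finite_ex_min:
  fixes g :: "'b \<Rightarrow> 'a"
  assumes "finite F" "F \<noteq> {}"
  shows "\<exists>p\<in>F. \<forall>q\<in>F. g p \<le> g q"
  using finite_ex_max[OF assms, of "\<lambda>p. - g p"] by auto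

lemma lsum_residue:
  "\<forall>i\<in>S. \<exists>c. W i = V i + nmul R c \<Longrightarrow> set ps \<subseteq> S \<Longrightarrow> \<exists>c. lsum W ps = lsum V ps + nmul R c"
proof (induction ps)
  case Nil
  show ?case by (rule exI[of _ 0]) simp
next
  case (Cons i ps)
  then obtain c d where "W i = V i + nmul R c" "lsum W ps = lsum V ps + nmul R d" by auto
  then have "lsum W (i # ps) = lsum V (i # ps) + nmul R (c + d)"
    by (simp add: nmul_add_right ac_simps)
  then show ?case by blast
qed

lemma diff_add_less_iff: "q - p + p' < q' \<longleftrightarrow> q + p' < p + q'"
  "q' < q - p + p' \<longleftrightarrow> p + q' < q + p'"
  "q - p < q' - p' \<longleftrightarrow> q + p' < q' + p"
  by (simp_all add: algebra_simps)

text \<open>The back-and-forth step: the position of \<open>L \<cdot> a\<close> among the finitely many values of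
  differences of bounded sums in \<open>V\<close> is copied to the other side, density keeping the residue.\<close>

lemma agree_extend:
  assumes L: "\<forall>k\<in>{1..N}. k dvd L" "L > 0" and N: "N > 0" and R: "R > 0"
    and dense: "\<And>n a b. 0 < n \<Longrightarrow> a < b \<Longrightarrow> \<exists>c. a < nmul n c \<and> nmul n c < b"
    and S: "finite S" "x \<notin> S" "k \<in> S"
    and ag: "agree (2 * L * N) (L * R) S V W"
    and a: "0 \<le> a" "a < V k"
  shows "\<exists>b. agree N R (insert x S) (V(x := a)) (W(x := b))"
proof -
  \<comment> \<open>\<open>T\<close> holds the lists that arise from normalization. Comparing two
    differences of their sums takes lists of twice the length, hence \<open>2 * L * N\<close> in the
    hypothesis.\<close>
  define T where "T = {ps. set ps \<subseteq> S \<and> length ps \<le> L * N}"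
  have finT: "finite (T \<times> T)"
    unfolding T_def using finite_lists_length_le[OF S(1)] by blast
  have agT: "lsum V (p @ q') < lsum V (q @ p') \<longleftrightarrow> lsum W (p @ q') < lsum W (q @ p')"
    if "p \<in> T" "q \<in> T" "p' \<in> T" "q' \<in> T" for p q p' q'
    by (rule agree_less[OF ag]) (use that in \<open>auto simp: T_def\<close>)
  have upd: "lsum (V(x := a)) ps = lsum V ps" "lsum (W(x := b)) ps = lsum W ps"
    if "set ps \<subseteq> S" for ps b
    using that S(2) by (auto intro!: lsum_cong)
  have finish: ?thesis
    if b: "b = a + nmul R c"
      and l: "\<And>p q. p \<in> T \<Longrightarrow> q \<in> T \<Longrightarrow> nmul L a + lsum V p < lsum V q \<longleftrightarrow> nmul L b + lsum W p < lsum W q"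
      and g: "\<And>p q. p \<in> T \<Longrightarrow> q \<in> T \<Longrightarrow> lsum V q < nmul L a + lsum V p \<longleftrightarrow> lsum W q < nmul L b + lsum W p"
    for b c
  proof (rule exI[of _ b], rule agree_insertI[OF L])
    have "N \<le> 2 * L * N" using L(2) by simp
    then have "agree N R S V W" by (intro agree_mono[OF ag]) auto
    moreover have "(V(x := a)) i = V i" "(W(x := b)) i = W i" if "i \<in> S" for i
      using that S(2) by auto
    ultimately show "agree N R S (V(x := a)) (W(x := b))"
      unfolding agree_def by (metis upd)
    show "(W(x := b)) x = (V(x := a)) x + nmul R c" using b by simp
  next
    fix p q assume *: "set p \<subseteq> S" "set q \<subseteq> S" "length p \<le> L * N" "length q \<le> L * N"
    then have "p \<in> T" "q \<in> T" by (auto simp: T_def)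
    then show "nmul L ((V(x := a)) x) + lsum (V(x := a)) p < lsum (V(x := a)) q \<longleftrightarrow>
        nmul L ((W(x := b)) x) + lsum (W(x := b)) p < lsum (W(x := b)) q"
      "lsum (V(x := a)) q < nmul L ((V(x := a)) x) + lsum (V(x := a)) p \<longleftrightarrow>
        lsum (W(x := b)) q < nmul L ((W(x := b)) x) + lsum (W(x := b)) p"
      unfolding upd(1)[OF *(1)] upd(1)[OF *(2)] upd(2)[OF *(1)] upd(2)[OF *(2)] fun_upd_same
      using l g by blast+
  qed
  have nil: "[] \<in> T" by (simp add: T_def)
  show ?thesis
  proof (cases "\<exists>p\<in>T. \<exists>q\<in>T. nmul L a + lsum V p = lsum V q")
    case True
    then obtain p q where pq: "p \<in> T" "q \<in> T" "nmul L a + lsum V p = lsum V q" by blast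
    have res: "\<forall>i\<in>S. \<exists>c. W i = V i + nmul (L * R) c"
      using ag unfolding agree_def by (rule conjunct2)
    have "set p \<subseteq> S" "set q \<subseteq> S" using pq(1,2) by (auto simp: T_def)
    then obtain c d where cd: "lsum W p = lsum V p + nmul (L * R) c"
      "lsum W q = lsum V q + nmul (L * R) d"
      using lsum_residue[OF res] by metis
    \<comment> \<open>\<open>L * b\<close> is forced to be \<open>lsum W q - lsum W p\<close>.
      Agreement modulo \<open>L * R\<close> makes this differ from \<open>L * a\<close> by a
      multiple of \<open>L * R\<close>; division by \<open>L\<close> gives a witness in the class of
      \<open>a\<close> modulo \<open>R\<close>.\<close>
    define b where "b = a + nmul R (d - c)"
    have "nmul L b = nmul L a + (nmul (L * R) d - nmul (L * R) c)"
      by (simp add: b_def nmul_add_right nmul_nmul nmul_diff)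
    then have b: "nmul L b + lsum W p = lsum W q"
      unfolding cd pq(3)[symmetric] by (simp add: algebra_simps)
    show ?thesis
    proof (rule finish[OF b_def])
      fix p' q' assume T': "p' \<in> T" "q' \<in> T"
      have eq: "nmul L a = lsum V q - lsum V p" "nmul L b = lsum W q - lsum W p"
        using pq(3) b by (auto simp: algebra_simps)
      have *: "nmul L a + lsum V p' < lsum V q' \<longleftrightarrow> lsum V (q @ p') < lsum V (p @ q')"
        "nmul L b + lsum W p' < lsum W q' \<longleftrightarrow> lsum W (q @ p') < lsum W (p @ q')"
        "lsum V q' < nmul L a + lsum V p' \<longleftrightarrow> lsum V (p @ q') < lsum V (q @ p')"
        "lsum W q' < nmul L b + lsum W p' \<longleftrightarrow> lsum W (p @ q') < lsum W (q @ p')"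
        unfolding eq lsum_simps by (rule diff_add_less_iff)+
      show "nmul L a + lsum V p' < lsum V q' \<longleftrightarrow> nmul L b + lsum W p' < lsum W q'"
        unfolding * using agT[OF pq(2,1) T'(2,1)] by (simp add: ac_simps)
      show "lsum V q' < nmul L a + lsum V p' \<longleftrightarrow> lsum W q' < nmul L b + lsum W p'"
        unfolding * using agT[OF pq(1,2) T'] by (simp add: ac_simps)
    qed
  next
    case False
    define lo where "lo = {(p, q) \<in> T \<times> T. lsum V q - lsum V p < nmul L a}"
    define hi where "hi = {(p, q) \<in> T \<times> T. nmul L a < lsum V q - lsum V p}"
    have fin: "finite lo" "finite hi"
      by (rule finite_subset[OF _ finT]; auto simp: lo_def hi_def)+
    \<comment> \<open>The bounds \<open>0 \<le> a < V k\<close> put the values \<open>0\<close> and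
      \<open>L * V k\<close> on the two sides of \<open>L * a\<close>, so neither side of the gap is
      empty.\<close>
    have "a \<noteq> 0" using False nil by force
    then have "nmul L 0 < nmul L a" using a(1) L(2) by (intro nmul_strict_mono) auto
    then have lo: "([], []) \<in> lo" using nil by (auto simp: lo_def)
    have "replicate L k \<in> T" using S(3) N by (auto simp: T_def)
    moreover have "nmul L a < nmul L (V k)" using a(2) L(2) by (rule nmul_strict_mono[rotated])
    ultimately have hi: "([], replicate L k) \<in> hi" using nil by (auto simp: hi_def)
    obtain r1 where r1: "r1 \<in> lo"
      "\<forall>r\<in>lo. lsum V (snd r) - lsum V (fst r) \<le> lsum V (snd r1) - lsum V (fst r1)"
      using finite_ex_max[OF fin(1), of "\<lambda>r. lsum V (snd r) - lsum V (fst r)"] lo by blast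
    obtain r2 where r2: "r2 \<in> hi"
      "\<forall>r\<in>hi. lsum V (snd r2) - lsum V (fst r2) \<le> lsum V (snd r) - lsum V (fst r)"
      using finite_ex_min[OF fin(2), of "\<lambda>r. lsum V (snd r) - lsum V (fst r)"] hi by blast
    obtain p1 q1 p2 q2 where rs: "r1 = (p1, q1)" "r2 = (p2, q2)" by (metis prod.collapse)
    have 1: "(p1, q1) \<in> lo" "\<And>p q. (p, q) \<in> lo \<Longrightarrow> lsum V q - lsum V p \<le> lsum V q1 - lsum V p1"
      using r1 rs by auto
    have 2: "(p2, q2) \<in> hi" "\<And>p q. (p, q) \<in> hi \<Longrightarrow> lsum V q2 - lsum V p2 \<le> lsum V q - lsum V p"
      using r2 rs by auto
    have T: "p1 \<in> T" "q1 \<in> T" "p2 \<in> T" "q2 \<in> T" using 1(1) 2(1) by (auto simp: lo_def hi_def)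
    have iff: "lsum V q - lsum V p < lsum V q' - lsum V p' \<longleftrightarrow>
        lsum W q - lsum W p < lsum W q' - lsum W p'"
      if "p \<in> T" "q \<in> T" "p' \<in> T" "q' \<in> T" for p q p' q'
      using agT[of q q' p p'] that unfolding diff_add_less_iff by (simp add: add.commute)
    have "lsum V q1 - lsum V p1 < lsum V q2 - lsum V p2"
      using 1(1) 2(1) by (auto simp: lo_def hi_def)
    then have "lsum W q1 - lsum W p1 < lsum W q2 - lsum W p2"
      using iff T by blast
    then have "lsum W q1 - lsum W p1 - nmul L a < lsum W q2 - lsum W p2 - nmul L a"
      by (rule diff_strict_right_mono)
    moreover have "0 < L * R" using L(2) R by simp
    \<comment> \<open>The shift of \<open>L * a\<close> is chosen among the multiples of
      \<open>L * R\<close>, so that after division by \<open>L\<close> it is a multiple of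
      \<open>R\<close>.\<close>
    ultimately obtain c where c: "lsum W q1 - lsum W p1 - nmul L a < nmul (L * R) c"
      "nmul (L * R) c < lsum W q2 - lsum W p2 - nmul L a"
      using dense by blast
    define b where "b = a + nmul R c"
    have b: "lsum W q1 - lsum W p1 < nmul L b" "nmul L b < lsum W q2 - lsum W p2"
      using c unfolding b_def nmul_add_right nmul_nmul
      by (simp_all only: diff_less_eq less_diff_eq add.commute)
    have low: "lsum W q < nmul L b + lsum W p" if "p \<in> T" "q \<in> T" "lsum V q < nmul L a + lsum V p" for p q
    proof -
      have "lsum V q - lsum V p \<le> lsum V q1 - lsum V p1"
        by (rule 1(2)) (use that in \<open>auto simp: lo_def diff_less_eq\<close>)
      then have "lsum W q - lsum W p \<le> lsum W q1 - lsum W p1"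
        using iff[of p1 q1 p q] that T by (simp add: not_less[symmetric])
      then have "lsum W q - lsum W p < nmul L b" using b(1) by (rule le_less_trans)
      then show ?thesis by (simp add: diff_less_eq)
    qed
    have high: "nmul L b + lsum W p < lsum W q" if "p \<in> T" "q \<in> T" "nmul L a + lsum V p < lsum V q" for p q
    proof -
      have "lsum V q2 - lsum V p2 \<le> lsum V q - lsum V p"
        by (rule 2(2)) (use that in \<open>auto simp: hi_def less_diff_eq\<close>)
      then have "lsum W q2 - lsum W p2 \<le> lsum W q - lsum W p"
        using iff[of p q p2 q2] that T by (simp add: not_less[symmetric])
      then have "nmul L b < lsum W q - lsum W p" using b(2) by (metis less_le_trans)
      then show ?thesis by (simp add: less_diff_eq)
    qed
    show ?thesis
    proof (rule finish[OF b_def])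
      fix p q assume pq: "p \<in> T" "q \<in> T"
      then consider "nmul L a + lsum V p < lsum V q" "nmul L b + lsum W p < lsum W q"
        | "lsum V q < nmul L a + lsum V p" "lsum W q < nmul L b + lsum W p"
        using low[OF pq] high[OF pq] False less_linear[of "nmul L a + lsum V p" "lsum V q"] by blast
      note cases = this
      show "nmul L a + lsum V p < lsum V q \<longleftrightarrow> nmul L b + lsum W p < lsum W q"
        by (rule cases) (metis less_asym)+
      show "lsum V q < nmul L a + lsum V p \<longleftrightarrow> lsum W q < nmul L b + lsum W p"
        by (rule cases) (metis less_asym)+
    qed
  qed
qed

section \<open>Density of the multiples of every positive integer\<close>

definition approximable :: "nat \<Rightarrow> 'a \<Rightarrow> bool" where
  "approximable n u \<longleftrightarrow> (\<forall>e>0. \<exists>c. u < nmul n c \<and> nmul n c < u + e)"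

text \<open>The tolerance \<open>e\<close> is split into \<open>w\<close> and \<open>e - w\<close>.
  Additivity is what carries one-sided approximation from the interval below \<open>z\<close> to the
  whole group.\<close>

lemma approximable_add:
  assumes "\<And>u. 0 < u \<Longrightarrow> \<exists>w. 0 < w \<and> w < u" "approximable n u" "approximable n v"
  shows "approximable n (u + v)"
  unfolding approximable_def
proof (intro allI impI)
  fix e :: 'a assume "0 < e"
  then obtain w where w: "0 < w" "w < e" using assms(1) by blast
  obtain c where c: "u < nmul n c" "nmul n c < u + w"
    using assms(2) w(1) unfolding approximable_def by blast
  have "0 < e - w" using w(2) by simp
  then obtain d where d: "v < nmul n d" "nmul n d < v + (e - w)"
    using assms(3) unfolding approximable_def by blast
  have "nmul n (c + d) < (u + w) + (v + (e - w))"
    unfolding nmul_add_right by (rule add_strict_mono[OF c(2) d(2)])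
  also have "\<dots> = u + v + e" by (simp add: algebra_simps)
  finally show "\<exists>c. u + v < nmul n c \<and> nmul n c < u + v + e"
    using add_strict_mono[OF c(1) d(1)] by (metis nmul_add_right)
qed

lemma approximable_shift: "approximable n (u + nmul n v) \<Longrightarrow> approximable n u"
  unfolding approximable_def
proof (intro allI impI)
  fix e :: 'a assume *: "\<forall>e>0. \<exists>c. u + nmul n v < nmul n c \<and> nmul n c < u + nmul n v + e" "0 < e"
  then obtain c where c: "u + nmul n v < nmul n c" "nmul n c < u + nmul n v + e" by blast
  have "u < nmul n (c - v)" "nmul n (c - v) < u + e"
    using c unfolding nmul_diff by (simp_all add: less_diff_eq diff_less_eq ac_simps)
  then show "\<exists>c. u < nmul n c \<and> nmul n c < u + e" by blast
qed

text \<open>The hypothesis reaches only primes and the interval from \<open>0\<close> to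
  \<open>z\<close>. Additivity yields the positive multiples of \<open>z\<close>, and a shift by a
  multiple of \<open>p\<close> yields all elements; composite \<open>n\<close> follow by nesting
  intervals.\<close>

lemma multiples_dense:
  assumes z: "0 < z"
    and dense: "\<And>u. 0 < u \<Longrightarrow> \<exists>w. 0 < w \<and> w < u"
    and prime_dense: "\<And>p a b. prime p \<Longrightarrow> 0 < a \<Longrightarrow> a < b \<Longrightarrow> b < z \<Longrightarrow> \<exists>c. a < nmul p c \<and> nmul p c < b"
    and cofinal: "\<And>u. \<exists>a k l. 0 \<le> a \<and> a < z \<and> u + nmul k z = a + nmul l z"
    and "0 < n" "x < y"
  shows "\<exists>c. x < nmul n c \<and> nmul n c < y"
proof -
  have small: "approximable p u" if "prime p" "0 < u" "u < z" for p u
    unfolding approximable_def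
  proof (intro allI impI)
    fix e :: 'a assume "0 < e"
    moreover have "0 < z - u" using that(3) by simp
    ultimately obtain w where w: "0 < w" "w < min e (z - u)" using dense[of "min e (z - u)"] by auto
    then have "u + w < z" by (simp add: less_diff_eq add.commute)
    moreover have "u + w < u + e" "u < u + w" using w by simp_all
    ultimately show "\<exists>c. u < nmul p c \<and> nmul p c < u + e"
      using prime_dense[OF that(1,2), of "u + w"] less_trans[of _ "u + w" "u + e"] by blast
  qed
  have one_z: "approximable p z" if "prime p" for p
  proof -
    obtain w where "0 < w" "w < z" using dense[OF z] by blast
    then have "approximable p (z - w + w)"
      by (intro approximable_add[OF dense] small[OF that]) (simp_all add: diff_less_eq)
    then show ?thesis by simp
  qed
  have mult_z: "approximable p (nmul (Suc k) z)" if "prime p" for p k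
    using one_z[OF that] by (induction k) (auto intro: approximable_add[OF dense])
  have all: "approximable p u" if p: "prime p" for p u
  proof -
    obtain a k l where a: "0 \<le> a" "a < z" "u + nmul k z = a + nmul l z" using cofinal by blast
    \<comment> \<open>Adding \<open>p * Suc k\<close> copies of \<open>z\<close> instead of
      \<open>p * k\<close> leaves a positive multiple of \<open>z\<close>, so that
      \<open>mult_z\<close> covers the case \<open>a = 0\<close>.\<close>
    have "k < p * Suc k" using prime_gt_0_nat[OF p] by (cases p) auto
    then obtain m where m: "p * Suc k = k + Suc m" by (metis less_imp_Suc_add add_Suc_right)
    have "u + nmul p (nmul (Suc k) z) = (u + nmul k z) + nmul (Suc m) z"
      unfolding nmul_nmul m nmul_add_left by (simp add: add.assoc)
    also have "\<dots> = a + nmul (Suc (l + m)) z"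
      unfolding a(3) add.assoc nmul_add_left[symmetric] by (simp add: nmul_add_left ac_simps)
    finally have eq: "u + nmul p (nmul (Suc k) z) = a + nmul (Suc (l + m)) z" .
    have "approximable p (a + nmul (Suc (l + m)) z)"
    proof (cases "a = 0")
      case True
      then show ?thesis using mult_z[OF p, of "l + m"] by simp
    next
      case False
      then have "approximable p a" using small[OF p] a(1,2) by simp
      then show ?thesis by (intro approximable_add[OF dense] mult_z p)
    qed
    then show ?thesis unfolding eq[symmetric] by (rule approximable_shift)
  qed
  show ?thesis using \<open>0 < n\<close> \<open>x < y\<close>
  proof (induction n arbitrary: x y rule: less_induct)
    case (less n)
    show ?case
    proof (cases "n = 1")
      case True
      have "0 < y - x" using less.prems by simp
      then obtain w where "0 < w" "w < y - x" using dense by blast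
      then have "x < x + w" "w + x < y" by (simp_all add: less_diff_eq)
      then have "x < x + w" "x + w < y" by (simp_all add: add.commute)
      then have "x < nmul n (x + w)" "nmul n (x + w) < y" using True by simp_all
      then show ?thesis by blast
    next
      case False
      obtain p where p: "prime p" "p dvd n" using prime_factor_nat[OF False] by blast
      then obtain m where m: "n = p * m" by blast
      have between: "\<exists>c. x < nmul p c \<and> nmul p c < y" if "x < y" for x y
        using all[OF p(1), of x] that unfolding approximable_def
        by (metis add_diff_cancel_left' add_diff_cancel_right' diff_add_cancel add.commute diff_gt_0_iff_gt)
      \<comment> \<open>Two multiples \<open>p * c < p * d\<close> inside the interval leave room
        for a multiple of \<open>m\<close> between \<open>c\<close> and \<open>d\<close>;
        \<open>p\<close> times it is a multiple of \<open>n\<close>.\<close>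
      obtain c where c: "x < nmul p c" "nmul p c < y" using between less.prems by blast
      obtain d where d: "nmul p c < nmul p d" "nmul p d < y" using between c by blast
      have p0: "0 < p" using p(1) by (rule prime_gt_0_nat)
      have "c < d" using d(1) nmul_less_iff[OF p0] by simp
      moreover have "m < n" "0 < m" using m less.prems(1) prime_gt_1_nat[OF p(1)] by auto
      ultimately obtain e where e: "c < nmul m e" "nmul m e < d" using less.IH by blast
      have "nmul p c < nmul n e" "nmul n e < nmul p d"
        using e unfolding m nmul_nmul[symmetric] nmul_less_iff[OF p0] by simp_all
      then show ?thesis using c(1) d(2) less_trans by blast
    qed
  qed
qed

end

section \<open>The linearly ordered cover\<close>

locale oriented_group =
  fixes M :: "'a ostruct"
  assumes oag: "oriented_abelian_group M"
begin

definition adiff :: "'a \<Rightarrow> 'a \<Rightarrow> 'a" where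
  "adiff a b = oadd M a (oneg M b)"

sublocale A: ab_group_add "oadd M" "ozero M" adiff "oneg M"
proof -
  have "adiff = (\<lambda>a b. oadd M a (oneg M b))" by (intro ext) (simp add: adiff_def)
  then show "class.ab_group_add (oadd M) (ozero M) adiff (oneg M)"
    using oag unfolding oriented_abelian_group_def by simp
qed

abbreviation add (infixl "\<oplus>" 65) where "a \<oplus> b \<equiv> oadd M a b"
abbreviation neg ("\<ominus> _" [81] 80) where "\<ominus> a \<equiv> oneg M a"
abbreviation zer ("\<zero>") where "\<zero> \<equiv> ozero M"
abbreviation cyc where "cyc \<equiv> ocyc M"

lemma cyc_rot: "cyc a b c \<Longrightarrow> cyc b c a"
  and cyc_asym: "cyc a b c \<Longrightarrow> \<not> cyc c b a"
  and cyc_trans: "cyc a b c \<Longrightarrow> cyc a c d \<Longrightarrow> cyc a b d"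
  and cyc_total: "a \<noteq> b \<Longrightarrow> b \<noteq> c \<Longrightarrow> a \<noteq> c \<Longrightarrow> cyc a b c \<or> cyc c b a"
  and cyc_add: "cyc a b c \<Longrightarrow> cyc (a \<oplus> d) (b \<oplus> d) (c \<oplus> d)"
  using oag unfolding oriented_abelian_group_def by blast+

lemma cyc_distinct: "cyc a b c \<Longrightarrow> a \<noteq> b \<and> b \<noteq> c \<and> a \<noteq> c"
  by (metis cyc_rot cyc_asym)

lemma cyc_add_iff: "cyc (d \<oplus> a) (d \<oplus> b) (d \<oplus> c) \<longleftrightarrow> cyc a b c"
proof
  assume "cyc (d \<oplus> a) (d \<oplus> b) (d \<oplus> c)"
  from cyc_add[OF this, of "\<ominus> d"] show "cyc a b c" by (simp add: A.add.commute A.add.left_commute)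
next
  assume "cyc a b c"
  then show "cyc (d \<oplus> a) (d \<oplus> b) (d \<oplus> c)" by (metis cyc_add A.add.commute)
qed

text \<open>The cycle is cut open at zero, which becomes the least element. The first disjunct
  supplies the comparisons with zero, since \<open>cyc\<close> holds only for distinct
  points.\<close>

definition lt :: "'a \<Rightarrow> 'a \<Rightarrow> bool" where
  "lt a b \<longleftrightarrow> a = \<zero> \<and> b \<noteq> \<zero> \<or> cyc \<zero> a b"

lemma lt_irrefl [simp]: "\<not> lt a a"
  using cyc_distinct by (auto simp: lt_def)

lemma lt_trans: "lt a b \<Longrightarrow> lt b c \<Longrightarrow> lt a c"
  unfolding lt_def by (metis cyc_trans cyc_distinct)

lemma lt_linear: "lt a b \<or> a = b \<or> lt b a"
  unfolding lt_def by (metis cyc_total cyc_rot)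

lemma lt_asym: "lt a b \<Longrightarrow> \<not> lt b a"
  using lt_trans lt_irrefl by blast

lemma not_lt_zero [simp]: "\<not> lt a \<zero>"
  using cyc_distinct by (auto simp: lt_def)

lemma zero_lt_iff [simp]: "lt \<zero> a \<longleftrightarrow> a \<noteq> \<zero>"
  using lt_linear[of \<zero> a] not_lt_zero by auto

lemma lt_imp_cyc:
  assumes "lt a b" "lt b c"
  shows "cyc a b c"
proof -
  have "b \<noteq> \<zero>" using assms(1) not_lt_zero by blast
  then have bc: "cyc \<zero> b c" using assms(2) unfolding lt_def by blast
  show ?thesis
  proof (cases "a = \<zero>")
    case False
    then have "cyc \<zero> a b" using assms(1) unfolding lt_def by blast
    then show ?thesis using bc cyc_rot cyc_trans by blast
  qed (use bc in simp)
qed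

lemma cyc_iff_lt: "cyc a b c \<longleftrightarrow> lt a b \<and> lt b c \<or> lt b c \<and> lt c a \<or> lt c a \<and> lt a b"
proof
  assume c: "cyc a b c"
  have "\<not> (lt c b \<and> lt b a)" "\<not> (lt b a \<and> lt a c)" "\<not> (lt a c \<and> lt c b)"
    using lt_imp_cyc[of c b a] lt_imp_cyc[of b a c] lt_imp_cyc[of a c b]
      cyc_asym[OF c] cyc_asym[OF cyc_rot[OF c]] cyc_asym[OF cyc_rot[OF cyc_rot[OF c]]] by blast+
  then show "lt a b \<and> lt b c \<or> lt b c \<and> lt c a \<or> lt c a \<and> lt a b"
    using cyc_distinct[OF c] lt_linear[of a b] lt_linear[of b c] lt_linear[of a c] by blast
next
  assume "lt a b \<and> lt b c \<or> lt b c \<and> lt c a \<or> lt c a \<and> lt a b"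
  then show "cyc a b c"
    using lt_imp_cyc[of a b c] cyc_rot[OF cyc_rot[OF lt_imp_cyc[of b c a]]]
      cyc_rot[OF lt_imp_cyc[of c a b]] by blast
qed

text \<open>Each strict case also records the comparison that transitivity gives, which turns the
  identities about carries into case checks.\<close>

lemma lt_cases :
  obtains "lt p q \<and> lt q r \<and> lt p r" | "lt p r \<and> lt r q \<and> lt p q"
  | "lt q p \<and> lt p r \<and> lt q r" | "lt q r \<and> lt r p \<and> lt q p"
  | "lt r p \<and> lt p q \<and> lt r q" | "lt r q \<and> lt q p \<and> lt r p"
  | "p = q" | "p = r" | "q = r"
  using lt_linear[of p q] lt_linear[of q r] lt_linear[of p r]
    lt_trans[of p q r] lt_trans[of p r q] lt_trans[of q p r] lt_trans[of q r p]
    lt_trans[of r p q] lt_trans[of r q p] by argo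

text \<open>Translation moves the viewpoint from zero to \<open>p\<close>. In this way carries based
  at different points become statements about the same three points.\<close>

lemma lt_shift: "lt x y \<longleftrightarrow> x = \<zero> \<and> y \<noteq> \<zero> \<or> cyc p (p \<oplus> x) (p \<oplus> y)"
  unfolding lt_def using cyc_add_iff[of p \<zero> x y] by simp

text \<open>A sum passes zero exactly when it drops below its first summand. This is the cocycle
  that describes the cover as an extension of \<open>A\<close> by the integers.\<close>

definition carry :: "'a \<Rightarrow> 'a \<Rightarrow> int" where
  "carry a b = of_bool (lt (a \<oplus> b) a)"

text \<open>Three of the four carries compare two of the points \<open>a\<close>,
  \<open>a + b\<close> and \<open>a + b + c\<close>. The carry of \<open>b\<close> and
  \<open>c\<close> becomes a statement about these points after translation by
  \<open>a\<close>.\<close>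

lemma carry_cocycle: "carry a b + carry (a \<oplus> b) c = carry b c + carry a (b \<oplus> c)"
proof -
  have "lt (b \<oplus> c) b \<longleftrightarrow> a \<oplus> b \<oplus> c = a \<and> a \<oplus> b \<noteq> a \<or> cyc a (a \<oplus> b \<oplus> c) (a \<oplus> b)"
    using lt_shift[of "b \<oplus> c" b a] A.add.assoc[of a b c] by simp
  then show ?thesis
    unfolding carry_def A.add.assoc[symmetric] cyc_iff_lt[of a]
    using lt_linear[of a "a \<oplus> b"] lt_linear[of a "a \<oplus> b \<oplus> c"]
    by (cases rule: lt_cases[of a "a \<oplus> b" "a \<oplus> b \<oplus> c"]) (auto dest: lt_asym)
qed

lemma lt_neg:
  assumes "lt x y" "x \<noteq> \<zero>"
  shows "lt (\<ominus> y) (\<ominus> x)"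
proof (rule ccontr)
  assume "\<not> lt (\<ominus> y) (\<ominus> x)"
  moreover have "\<ominus> x \<noteq> \<ominus> y" using assms(1) by auto
  ultimately have 1: "lt (\<ominus> x) (\<ominus> y)" using lt_linear[of "\<ominus> x" "\<ominus> y"] by blast
  have x': "cyc \<zero> x y" using assms unfolding lt_def by blast
  have "\<ominus> x \<noteq> \<zero>" using assms(2) by simp
  then have y': "cyc \<zero> (\<ominus> x) (\<ominus> y)" using 1 unfolding lt_def by blast
  have "cyc (\<ominus> y) (\<ominus> y \<oplus> x) \<zero>"
    using cyc_add_iff[of "\<ominus> y" \<zero> x y] x' by simp
  then have a: "lt (\<ominus> y) (\<ominus> y \<oplus> x)" unfolding lt_def by (blast intro: cyc_rot)
  have "cyc y (y \<oplus> \<ominus> x) \<zero>"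
    using cyc_add_iff[of "y" \<zero> "\<ominus> x" "\<ominus> y"] y' by simp
  then have b: "lt y (y \<oplus> \<ominus> x)" unfolding lt_def by (blast intro: cyc_rot)
  have "cyc x \<zero> (x \<oplus> \<ominus> y)"
    using cyc_add_iff[of "x" \<zero> "\<ominus> x" "\<ominus> y"] y' by simp
  then have c: "lt (x \<oplus> \<ominus> y) x" unfolding lt_def by (blast intro: cyc_rot)
  have "cyc (\<ominus> x) \<zero> (\<ominus> x \<oplus> y)"
    using cyc_add_iff[of "\<ominus> x" \<zero> x y] x' by simp
  then have d: "lt (\<ominus> x \<oplus> y) (\<ominus> x)" unfolding lt_def by (blast intro: cyc_rot)
  \<comment> \<open>The four facts give \<open>y < - x\<close> and \<open>- y < x\<close>; together
    with \<open>- x < - y\<close> this yields \<open>y < x\<close>, against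
    \<open>x < y\<close>.\<close>
  show False
    using lt_trans[OF b d[unfolded A.add.commute[of _ y]]] lt_trans[OF a c[unfolded A.add.commute[of x]]]
      1 assms(1) lt_trans[of y "\<ominus> x" "\<ominus> y"] lt_trans[of y "\<ominus> y" x] lt_asym[of x y] by blast
qed

lemma lt_add_iff: "a \<noteq> \<zero> \<Longrightarrow> a \<oplus> b \<noteq> \<zero> \<Longrightarrow> lt (a \<oplus> b) a \<longleftrightarrow> lt (\<ominus> a) b"
  using lt_shift[of "\<ominus> a" b a] cyc_iff_lt[of a \<zero> "a \<oplus> b"] by auto

text \<open>If no zero is involved, a carry means \<open>- a < b\<close>; this is symmetric because
  negation reverses the order of nonzero elements.\<close>

lemma carry_commute: "carry a b = carry b a"
proof (cases "a = \<zero> \<or> b = \<zero> \<or> a \<oplus> b = \<zero>")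
  case True
  then show ?thesis by (auto simp: carry_def A.add.commute)
next
  case False
  have "lt (\<ominus> b) a" if "lt (\<ominus> a) b" "a \<noteq> \<zero>" for a b
    using lt_neg[OF that(1)] that(2) by simp
  then have "lt (\<ominus> a) b \<longleftrightarrow> lt (\<ominus> b) a" using False by blast
  then show ?thesis
    using False lt_add_iff[of a b] lt_add_iff[of b a] by (simp add: carry_def A.add.commute)
qed

section \<open>The extension of \<open>A\<close> by the integers\<close>

definition uplus :: "int \<times> 'a \<Rightarrow> int \<times> 'a \<Rightarrow> int \<times> 'a" where
  "uplus x y = (fst x + fst y + carry (snd x) (snd y), snd x \<oplus> snd y)"

text \<open>A nonzero element and its inverse always carry when added, which has to be compensated
  by one.\<close>

definition uneg :: "int \<times> 'a \<Rightarrow> int \<times> 'a" where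
  "uneg x = (- fst x - of_bool (snd x \<noteq> \<zero>), \<ominus> snd x)"

definition udiff :: "int \<times> 'a \<Rightarrow> int \<times> 'a \<Rightarrow> int \<times> 'a" where
  "udiff x y = uplus x (uneg y)"

definition uless :: "int \<times> 'a \<Rightarrow> int \<times> 'a \<Rightarrow> bool" where
  "uless x y \<longleftrightarrow> fst x < fst y \<or> fst x = fst y \<and> lt (snd x) (snd y)"

definition uless_eq :: "int \<times> 'a \<Rightarrow> int \<times> 'a \<Rightarrow> bool" where
  "uless_eq x y \<longleftrightarrow> uless x y \<or> x = y"

lemma uless_irrefl: "\<not> uless x x"
  by (auto simp: uless_def)

lemma uless_trans: "uless x y \<Longrightarrow> uless y z \<Longrightarrow> uless x z"
  unfolding uless_def by (auto dest: lt_trans)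

lemma uless_linear: "uless x y \<or> x = y \<or> uless y x"
  unfolding uless_def using lt_linear[of "snd x" "snd y"] by (auto simp: prod_eq_iff)

text \<open>Only carries could disturb the lexicographic order. After translation by
  \<open>snd w\<close> they are all read off from the order of \<open>snd w\<close> and the two
  sums.\<close>

lemma uplus_mono: "uless x y \<Longrightarrow> uless (uplus w x) (uplus w y)"
proof -
  assume l: "uless x y"
  let ?p = "snd w" let ?q = "?p \<oplus> snd x" let ?r = "?p \<oplus> snd y"
  have "lt (snd y) (snd x) \<longleftrightarrow> ?r = ?p \<and> ?q \<noteq> ?p \<or> cyc ?p ?r ?q"
    using lt_shift[of "snd y" "snd x" ?p] by simp
  then show ?thesis
    using l lt_linear[of "snd x" "snd y"] lt_asym[of "snd x" "snd y"]
      lt_linear[of ?p ?q] lt_linear[of ?p ?r]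
    unfolding uless_def uplus_def carry_def cyc_iff_lt[of ?p]
    by (cases rule: lt_cases[of ?p ?q ?r]) (auto dest: lt_asym)
qed

sublocale U: linordered_ab_group_add uplus "(0, \<zero>)" udiff uneg uless_eq uless
proof
  show "uplus (uplus x y) z = uplus x (uplus y z)" for x y z
    using carry_cocycle[of "snd x" "snd y" "snd z"] by (simp add: uplus_def A.add.assoc)
  show "uplus x y = uplus y x" for x y
    by (simp add: uplus_def carry_commute A.add.commute)
  show "uplus (0, \<zero>) x = x" for x
    by (simp add: uplus_def carry_def)
  show "uplus (uneg x) x = (0, \<zero>)" for x
    by (simp add: uplus_def uneg_def carry_def)
  show "udiff x y = uplus x (uneg y)" for x y by (rule udiff_def)
  show "uless x y \<longleftrightarrow> uless_eq x y \<and> \<not> uless_eq y x" for x y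
    unfolding uless_eq_def using uless_irrefl uless_trans by blast
  show "uless_eq x x" for x by (simp add: uless_eq_def)
  show "uless_eq x y \<Longrightarrow> uless_eq y z \<Longrightarrow> uless_eq x z" for x y z
    unfolding uless_eq_def using uless_trans by blast
  show "uless_eq x y \<Longrightarrow> uless_eq y x \<Longrightarrow> x = y" for x y
    unfolding uless_eq_def using uless_irrefl uless_trans by blast
  show "uless_eq x y \<or> uless_eq y x" for x y
    unfolding uless_eq_def using uless_linear by blast
  show "uless_eq x y \<Longrightarrow> uless_eq (uplus w x) (uplus w y)" for x y w
    unfolding uless_eq_def using uplus_mono by blast
qed

lemma uplus_pair: "uplus (i, a) (j, b) = (i + j + carry a b, a \<oplus> b)"
  by (simp add: uplus_def)

lemma fst_uplus: "fst (uplus u v) = fst u + fst v + carry (snd u) (snd v)"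
  and snd_uplus: "snd (uplus u v) = snd u \<oplus> snd v"
  by (simp_all add: uplus_def)

section \<open>Lifts to the interval below one turn\<close>

definition lift :: "'a \<Rightarrow> int \<times> 'a" where
  "lift a = (0, a)"

definition turn :: "int \<times> 'a" where
  "turn = (1, \<zero>)"

lemma lift_nonneg: "uless_eq (0, \<zero>) (lift a)"
  by (auto simp: uless_eq_def uless_def lift_def)

lemma lift_less_turn: "uless (lift a) turn"
  by (simp add: uless_def lift_def turn_def)

lemma turn_pos: "uless (0, \<zero>) turn"
  by (simp add: uless_def turn_def)

lemma lift_less_iff: "uless (lift a) (lift b) \<longleftrightarrow> lt a b"
  by (simp add: uless_def lift_def)

lemma lift_eq_iff [simp]: "lift a = lift b \<longleftrightarrow> a = b"
  by (simp add: lift_def)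

lemma lift_zero [simp]: "lift \<zero> = (0, \<zero>)"
  by (simp add: lift_def)

lemma lift_exhaust:
  assumes "uless_eq (0, \<zero>) u" "uless u turn"
  obtains a where "u = lift a"
proof -
  have "fst u = 0" using assms by (auto simp: uless_eq_def uless_def turn_def)
  then show thesis using that by (metis lift_def prod.collapse)
qed

lemma uplus_lift: "uplus (lift a) (lift b) = (carry a b, a \<oplus> b)"
  by (simp add: uplus_def lift_def)

lemma carry_less: "uless (uplus (lift a) (lift b)) turn \<longleftrightarrow> carry a b = 0"
  by (auto simp: uplus_lift turn_def uless_def carry_def)

text \<open>The carry appears in the cover as a comparison with \<open>turn\<close>; through this,
  agreement on bounded sums controls the addition of \<open>A\<close>.\<close>

lemma lift_add:
  "uless (uplus (lift a) (lift b)) turn \<Longrightarrow> lift (a \<oplus> b) = uplus (lift a) (lift b)"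
  "\<not> uless (uplus (lift a) (lift b)) turn \<Longrightarrow> uplus turn (lift (a \<oplus> b)) = uplus (lift a) (lift b)"
  unfolding carry_less by (auto simp: carry_def uplus_lift lift_def turn_def uplus_def)

lemma lift_neg: "a \<noteq> \<zero> \<Longrightarrow> uplus (lift (\<ominus> a)) (lift a) = turn"
  by (simp add: uplus_lift turn_def carry_def)

lemma nmul_turn: "U.nmul n turn = (int n, \<zero>)"
  by (induction n) (auto simp: turn_def uplus_pair carry_def)

lemma snd_nmul: "snd (U.nmul n u) = omult M n (snd u)"
  by (induction n) (auto simp: omult_def snd_uplus)

text \<open>\<open>nmul\<close> takes natural coefficients, so a negative integer part is moved to
  the other side.\<close>

lemma cover_decompose: "uplus (lift (snd u)) (U.nmul (nat (fst u)) turn) = uplus u (U.nmul (nat (- fst u)) turn)"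
  unfolding nmul_turn by (auto simp: uplus_def lift_def carry_def)

lemma omult_add: "omult M (m + n) a = omult M m a \<oplus> omult M n a"
  by (induction m) (auto simp: omult_def A.add.assoc)

lemma omult_omult: "omult M m (omult M n a) = omult M (m * n) a"
  by (induction m) (auto simp: omult_add, auto simp: omult_def)

end

section \<open>Divisibility and density in the cover\<close>

locale regular_group = oriented_group +
  assumes regular: "regularly_dense M"
    and index_one: "\<And>p. prime p \<Longrightarrow> index_is_power M p 0"
    and nontrivial: "\<exists>a. a \<noteq> \<zero>"
begin

lemma prime_divisible:
  assumes "prime p"
  shows "\<exists>b. omult M p b = a"
proof -
  have "card (cosets_mult M p) = 1"
    using index_one[OF assms] by (simp add: index_is_power_def zero_enat_def)
  then obtain C where C: "cosets_mult M p = {C}" by (auto simp: card_1_singleton_iff)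
  have mem: "oadd M b ` range (omult M p) \<in> cosets_mult M p" for b by (auto simp: cosets_mult_def)
  have "oadd M \<zero> ` range (omult M p) = C" "oadd M a ` range (omult M p) = C"
    using mem unfolding C by blast+
  then have "oadd M \<zero> ` range (omult M p) = oadd M a ` range (omult M p)" by simp
  moreover have "oadd M \<zero> ` range (omult M p) = range (omult M p)" by simp
  moreover have "omult M p \<zero> = \<zero>"
    using snd_nmul[of p "(0, \<zero>)"] by simp
  then have "a \<oplus> \<zero> \<in> oadd M a ` range (omult M p)" by (metis imageI rangeI)
  ultimately show ?thesis by auto
qed

lemma divisible: "0 < n \<Longrightarrow> \<exists>b. omult M n b = a"
proof (induction n arbitrary: a rule: less_induct)
  case (less n)
  show ?case
  proof (cases "n = 1")
    case True
    then show ?thesis by (auto simp: omult_def)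
  next
    case False
    obtain p where p: "prime p" "p dvd n" using prime_factor_nat[OF False] by blast
    then obtain m where m: "n = p * m" by blast
    obtain b where b: "omult M p b = a" using prime_divisible[OF p(1)] by blast
    have "m < n" "0 < m" using m less.prems prime_gt_1_nat[OF p(1)] by auto
    then obtain c where "omult M m c = b" using less.IH by blast
    then show ?thesis using b m omult_omult[of p m c] by auto
  qed
qed

text \<open>In a group of two elements the nonzero one has no half.\<close>

lemma ex_third_element: "a \<noteq> \<zero> \<Longrightarrow> \<exists>b. b \<noteq> \<zero> \<and> b \<noteq> a"
proof (rule ccontr)
  assume a: "a \<noteq> \<zero>" "\<nexists>b. b \<noteq> \<zero> \<and> b \<noteq> a"
  obtain b where b: "omult M 2 b = a" using divisible[of 2] by auto
  have "omult M 2 b = b \<oplus> b" by (simp add: omult_def numeral_2_eq_2)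
  with b a(1) have "b \<noteq> \<zero>" by auto
  with a(2) have "b = a" by blast
  with b \<open>omult M 2 b = b \<oplus> b\<close> show False using a(1) by simp
qed

text \<open>The chain condition of regular density says that adding up \<open>p\<close> copies of
  \<open>c\<close> never passes zero. Hence multiplication by \<open>p\<close> commutes with lifting
  \<open>c\<close>, and the betweenness in \<open>A\<close> becomes one in the cover.\<close>

lemma regularE:
  assumes "prime p" "a \<noteq> \<zero>" "lt a b"
  obtains c where "uless (lift a) (U.nmul p (lift c))" "uless (U.nmul p (lift c)) (lift b)"
proof -
  have ab: "cyc \<zero> a b" using assms by (auto simp: lt_def)
  then obtain c where c: "cyc a (omult M p c) b"
    "\<And>i. i \<in> {1..p - 1} \<Longrightarrow> less0 M (omult M i c) (omult M (i + 1) c)"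
    using regular assms(1) unfolding regularly_dense_def by blast
  have "1 \<le> n \<Longrightarrow> n \<le> p \<Longrightarrow> U.nmul n (lift c) = lift (omult M n c)" for n
  proof (induction n)
    case (Suc n)
    show ?case
    proof (cases "n = 0")
      case True
      then show ?thesis by (simp add: omult_def lift_def)
    next
      case False
      then have "less0 M (omult M n c) (omult M (n + 1) c)" using Suc.prems by (intro c(2)) auto
      then have "lt (omult M n c) (c \<oplus> omult M n c)" by (auto simp: less0_def lt_def omult_def)
      then have "carry (omult M n c) c = 0"
        using lt_asym by (auto simp: carry_def A.add.commute)
      then show ?thesis
        using False Suc by (simp add: uplus_lift carry_commute[of c], simp add: lift_def omult_def)
    qed
  qed simp
  then have eq: "U.nmul p (lift c) = lift (omult M p c)"
    using prime_gt_0_nat[OF assms(1)] by simp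
  have "lt a (omult M p c)" "lt (omult M p c) b"
    using c(1) assms(3) lt_asym[of a b] unfolding cyc_iff_lt by blast+
  then show thesis using that[of c] by (simp add: eq lift_less_iff)
qed

text \<open>A least positive element is the lift of a least nonzero \<open>b\<close>. If
  \<open>b < b + b\<close>, density for the prime 2 puts some \<open>2 * c\<close> strictly between
  \<open>b\<close> and \<open>2 * b\<close>, and \<open>2 * c - b\<close> is smaller. Otherwise
  \<open>b\<close> is its own inverse, and the order reversal of negation contradicts the existence
  of a third element.\<close>

lemma cover_no_least:
  assumes "uless (0, \<zero>) u"
  shows "\<exists>w. uless (0, \<zero>) w \<and> uless w u"
proof (rule ccontr)
  assume none: "\<nexists>w. uless (0, \<zero>) w \<and> uless w u"
  then have none': "u = w \<or> uless u w" if "uless (0, \<zero>) w" for w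
    using that uless_linear[of u w] by blast
  obtain a where a: "a \<noteq> \<zero>" using nontrivial by blast
  then have "uless u turn" 
    using none' U.le_less_trans[of u "lift a" turn] lift_less_turn lift_less_iff[of \<zero> a]
    unfolding uless_eq_def by (metis lift_zero zero_lt_iff)
  then obtain b where b: "u = lift b"
    using lift_exhaust assms unfolding uless_eq_def by blast
  have b0: "b \<noteq> \<zero>" using assms U.less_irrefl unfolding b by force
  have min: "b = x \<or> lt b x" if "x \<noteq> \<zero>" for x
    using none'[of "lift x"] that lift_less_iff[of \<zero> x] lift_less_iff[of b x] by (simp add: b)
  show False
  proof (cases "lt b (b \<oplus> b)")
    case True
    then have bb: "uplus (lift b) (lift b) = lift (b \<oplus> b)"
      using lt_asym[OF True] by (simp add: uplus_lift, simp add: lift_def carry_def)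
    obtain c where c: "uless (lift b) (U.nmul 2 (lift c))" "uless (U.nmul 2 (lift c)) (lift (b \<oplus> b))"
      using regularE[OF two_is_prime_nat b0 True] .
    define w where "w = udiff (U.nmul 2 (lift c)) (lift b)"
    have "uless (0, \<zero>) w" using c(1) by (simp add: w_def)
    moreover have "uless w u" using c(2) by (simp add: w_def b bb[symmetric] U.diff_less_eq)
    ultimately show False using none by blast
  next
    case False
    then have "b \<oplus> b = \<zero>" using min[of "b \<oplus> b"] b0 by auto
    then have neg: "\<ominus> b = b" using A.minus_unique by blast
    obtain x where x: "x \<noteq> \<zero>" "x \<noteq> b" using ex_third_element[OF b0] by blast
    then have "lt b x" using min by blast
    then have "lt (\<ominus> x) b" using lt_neg[of b x] b0 neg by simp
    then show False using min[of "\<ominus> x"] lt_asym x by auto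
  qed
qed

lemma cover_dense:
  assumes "0 < n" "uless x y"
  shows "\<exists>c. uless x (U.nmul n c) \<and> uless (U.nmul n c) y"
proof (rule U.multiples_dense[OF turn_pos cover_no_least _ _ assms])
  fix p :: nat and u v assume *: "prime p" "uless (0, \<zero>) u" "uless u v" "uless v turn"
  obtain a where a: "u = lift a"
    using lift_exhaust * U.less_imp_le U.less_trans by metis
  obtain b where b: "v = lift b"
    using lift_exhaust * U.less_imp_le U.less_trans by metis
  have "a \<noteq> \<zero>" using *(2) uless_irrefl unfolding a by force
  moreover have "lt a b" using *(3) unfolding a b lift_less_iff .
  ultimately show "\<exists>c. uless u (U.nmul p c) \<and> uless (U.nmul p c) v"
    using regularE[OF *(1), of a b] unfolding a b by metis
next
  fix u
  show "\<exists>a k l. uless_eq (0, \<zero>) a \<and> uless a turn \<and> uplus u (U.nmul k turn) = uplus a (U.nmul l turn)"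
    using cover_decompose[of u] lift_nonneg lift_less_turn by metis
qed

text \<open>\<open>r\<close> counts the turns made when \<open>y\<close>, an \<open>R\<close>-th
  part of \<open>x\<close>, is added up \<open>R\<close> times; it is below \<open>R\<close> because
  \<open>lift y\<close> is below \<open>turn\<close>. So \<open>r\<close> indexes the finitely many
  classes modulo \<open>R\<close>.\<close>

lemma residue_exists:
  assumes "0 < R"
  shows "\<exists>r<R. \<exists>y. U.nmul R (lift y) = uplus (lift x) (U.nmul r turn)"
proof -
  obtain y where y: "omult M R y = x" using divisible[OF assms] by blast
  define k where "k = fst (U.nmul R (lift y))"
  have eq: "U.nmul R (lift y) = (k, x)"
    using snd_nmul[of R "lift y"] y by (simp add: k_def prod_eq_iff lift_def)
  have "uless (U.nmul R (lift y)) (U.nmul R turn)"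
    by (rule U.nmul_strict_mono[OF assms lift_less_turn])
  then have "k < int R" unfolding eq nmul_turn by (auto simp: uless_def)
  moreover have "0 \<le> k"
  proof -
    have "0 \<le> fst (U.nmul n (lift y))" for n
      by (induction n) (auto simp: fst_uplus carry_def lift_def)
    then show ?thesis by (simp add: k_def)
  qed
  ultimately have "nat k < R" "U.nmul R (lift y) = uplus (lift x) (U.nmul (nat k) turn)"
    unfolding eq nmul_turn by (auto simp: uplus_def lift_def carry_def)
  then show ?thesis by blast
qed

end

section \<open>Back-and-forth\<close>

context linordered_ab_group_add
begin

text \<open>The equation \<open>a + q = p\<close> represents \<open>a\<close> as a difference of two
  sums.\<close>

lemma repr_less_iff:
  assumes "a + q = p" "b + s = r"
  shows "a < b \<longleftrightarrow> p + s < r + q"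
proof -
  have "p + s < r + q \<longleftrightarrow> a + (q + s) < b + (q + s)"
    unfolding assms[symmetric] by (simp add: ac_simps)
  then show ?thesis by simp
qed

lemma repr_add:
  assumes "a + q = p" "b + s = r"
  shows "(a + b) + (q + s) = p + r"
  unfolding assms[symmetric] by (simp add: ac_simps)

end

text \<open>The \<open>+ 1\<close> for \<open>Add\<close> and \<open>Minus\<close> pays for the copy
  of \<open>turn\<close> that the lifted value may require.\<close>

primrec tsize :: "oterm \<Rightarrow> nat" where
  "tsize (Var n) = 1"
| "tsize Zero = 1"
| "tsize (Add s t) = tsize s + tsize t + 1"
| "tsize (Minus t) = tsize t + 1"

lemma tsize_pos: "0 < tsize t"
  by (induction t) auto

context oriented_group
begin

definition val :: "(nat \<Rightarrow> 'a) \<Rightarrow> nat option \<Rightarrow> int \<times> 'a" where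
  "val v i = (case i of None \<Rightarrow> turn | Some n \<Rightarrow> lift (v n))"

lemma val_simps [simp]: "val v None = turn" "val v (Some n) = lift (v n)"
  by (simp_all add: val_def)

lemma val_upd: "(val v)(Some n := lift a) = val (v(n := a))"
  by (auto simp: val_def fun_eq_iff split: option.split)

abbreviation msum :: "(nat \<Rightarrow> 'a) \<Rightarrow> nat option list \<Rightarrow> int \<times> 'a" where
  "msum v \<equiv> U.lsum (val v)"

definition agr :: "nat \<Rightarrow> nat \<Rightarrow> nat set \<Rightarrow> (nat \<Rightarrow> 'a) \<Rightarrow> (nat \<Rightarrow> 'a) \<Rightarrow> bool" where
  "agr N R X v w \<longleftrightarrow> U.agree N R (insert None (Some ` X)) (val v) (val w)"

lemma agr_less:
  assumes "agr N R X v w" "set ps \<subseteq> insert None (Some ` X)" "set qs \<subseteq> insert None (Some ` X)"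
    "length ps \<le> N" "length qs \<le> N"
  shows "uless (msum v ps) (msum v qs) \<longleftrightarrow> uless (msum w ps) (msum w qs)"
  using U.agree_less[OF assms(1)[unfolded agr_def] assms(2-)] .

lemma agr_eq:
  assumes "agr N R X v w" "set ps \<subseteq> insert None (Some ` X)" "set qs \<subseteq> insert None (Some ` X)"
    "length ps \<le> N" "length qs \<le> N"
  shows "msum v ps = msum v qs \<longleftrightarrow> msum w ps = msum w qs"
  using U.agree_eq[OF assms(1)[unfolded agr_def] assms(2-)] .

lemma agr_mono:
  assumes "agr N R X v w" "N' \<le> N" "R' dvd R" "X' \<subseteq> X"
  shows "agr N' R' X' v w"
  unfolding agr_def
  by (rule U.agree_mono[OF assms(1)[unfolded agr_def] assms(2,3)]) (use assms(4) in blast)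

lemma agr_sym: "agr N R X v w \<Longrightarrow> agr N R X w v"
  unfolding agr_def by (rule U.agree_sym)

text \<open>The same lists serve \<open>v\<close> and \<open>w\<close>: whether a sum carries and
  whether a negated value is zero is decided by comparisons of bounded sums, on which the
  assignments agree.\<close>

lemma lift_tval:
  assumes "agr N R X v w" "tvars t \<subseteq> X" "tsize t \<le> N"
  shows "\<exists>ps qs. set ps \<subseteq> insert None (Some ` X) \<and> set qs \<subseteq> insert None (Some ` X) \<and>
    length ps \<le> tsize t \<and> length qs \<le> tsize t \<and>
    uplus (lift (tval M v t)) (msum v qs) = msum v ps \<and>
    uplus (lift (tval M w t)) (msum w qs) = msum w ps"
  using assms(2,3)
proof (induction t)
  case (Var n)
  show ?case by (rule exI[of _ "[Some n]"], rule exI[of _ "[]"]) (use Var in auto)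
next
  case Zero
  show ?case by (rule exI[of _ "[]"], rule exI[of _ "[]"]) auto
next
  case (Add s t)
  obtain ps qs where s: "set ps \<subseteq> insert None (Some ` X)" "set qs \<subseteq> insert None (Some ` X)"
    "length ps \<le> tsize s" "length qs \<le> tsize s"
    "uplus (lift (tval M v s)) (msum v qs) = msum v ps"
    "uplus (lift (tval M w s)) (msum w qs) = msum w ps"
    using Add.IH(1) Add.prems by auto
  obtain ps' qs' where t: "set ps' \<subseteq> insert None (Some ` X)" "set qs' \<subseteq> insert None (Some ` X)"
    "length ps' \<le> tsize t" "length qs' \<le> tsize t"
    "uplus (lift (tval M v t)) (msum v qs') = msum v ps'"
    "uplus (lift (tval M w t)) (msum w qs') = msum w ps'"
    using Add.IH(2) Add.prems by auto
  let ?s = "\<lambda>v. uplus (lift (tval M v s)) (lift (tval M v t))"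
  have eqs: "uplus (?s v) (msum v (qs @ qs')) = msum v (ps @ ps')"
    "uplus (?s w) (msum w (qs @ qs')) = msum w (ps @ ps')"
    unfolding U.lsum_simps using U.repr_add[OF s(5) t(5)] U.repr_add[OF s(6) t(6)] .
  have less: "uless (?s v) turn \<longleftrightarrow> uless (msum v (ps @ ps')) (msum v (None # qs @ qs'))"
    "uless (?s w) turn \<longleftrightarrow> uless (msum w (ps @ ps')) (msum w (None # qs @ qs'))"
    using U.repr_less_iff[OF eqs(1) U.add_0_right, of turn]
      U.repr_less_iff[OF eqs(2) U.add_0_right, of turn] by simp_all
  have iff: "uless (?s v) turn \<longleftrightarrow> uless (?s w) turn"
    unfolding less by (rule agr_less[OF assms(1)]) (use s t Add.prems in auto)
  show ?case
  proof (cases "uless (?s v) turn")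
    case True
    then have "uplus (lift (tval M v (Add s t))) (msum v (qs @ qs')) = msum v (ps @ ps')"
      "uplus (lift (tval M w (Add s t))) (msum w (qs @ qs')) = msum w (ps @ ps')"
      using eqs iff by (simp_all add: lift_add(1))
    then show ?thesis
      using s t by (intro exI[of _ "ps @ ps'"] exI[of _ "qs @ qs'"]) auto
  next
    case False
    \<comment> \<open>A carry means that one turn must be subtracted, so \<open>None\<close> joins
      the subtracted list.\<close>
    have *: "uplus (lift (a \<oplus> b)) (uplus turn c) = uplus (uplus (lift a) (lift b)) c"
      if "\<not> uless (uplus (lift a) (lift b)) turn" for a b c
      unfolding lift_add(2)[OF that, symmetric] by (simp only: U.add.assoc U.add.left_commute U.add.commute)
    have "uplus (lift (tval M v (Add s t))) (msum v (None # qs @ qs')) = msum v (ps @ ps')"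
      "uplus (lift (tval M w (Add s t))) (msum w (None # qs @ qs')) = msum w (ps @ ps')"
      unfolding tval.simps U.lsum_simps(2) val_simps
      using eqs *[OF False] *[OF False[unfolded iff]] by simp_all
    then show ?thesis
      using s t by (intro exI[of _ "ps @ ps'"] exI[of _ "None # qs @ qs'"]) auto
  qed
next
  case (Minus t)
  obtain ps qs where t: "set ps \<subseteq> insert None (Some ` X)" "set qs \<subseteq> insert None (Some ` X)"
    "length ps \<le> tsize t" "length qs \<le> tsize t"
    "uplus (lift (tval M v t)) (msum v qs) = msum v ps"
    "uplus (lift (tval M w t)) (msum w qs) = msum w ps"
    using Minus.IH Minus.prems by auto
  have zero: "tval M u t = \<zero> \<longleftrightarrow> msum u ps = msum u qs"
    if "uplus (lift (tval M u t)) (msum u qs) = msum u ps" for u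
  proof -
    have "tval M u t = \<zero> \<longleftrightarrow> lift (tval M u t) = (0, \<zero>)" by (metis lift_eq_iff lift_zero)
    also have "\<dots> \<longleftrightarrow> msum u ps = msum u qs" unfolding that[symmetric] by auto
    finally show ?thesis .
  qed
  have iff: "tval M v t = \<zero> \<longleftrightarrow> tval M w t = \<zero>"
    unfolding zero[OF t(5)] zero[OF t(6)]
    by (rule agr_eq[OF assms(1)]) (use t Minus.prems in auto)
  show ?case
  proof (cases "tval M v t = \<zero>")
    case True
    then have "tval M v (Minus t) = \<zero>" "tval M w (Minus t) = \<zero>" using iff by simp_all
    then show ?thesis by (intro exI[of _ "[]"] exI[of _ "[]"] conjI) simp_all
  next
    case False
    have *: "uplus (lift (tval M u (Minus t))) (msum u ps) = msum u (None # qs)"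
      if "uplus (lift (tval M u t)) (msum u qs) = msum u ps" "tval M u t \<noteq> \<zero>" for u
      unfolding that(1)[symmetric] using lift_neg[OF that(2)]
      by (simp add: U.add.assoc[symmetric])
    show ?thesis
      using *[OF t(5)] *[OF t(6)] False iff t
      by (intro exI[of _ "None # qs"] exI[of _ ps]) auto
  qed
qed

lemma lt_tval:
  assumes "agr N R X v w" "tvars s \<subseteq> X" "tvars t \<subseteq> X" "tsize s + tsize t \<le> N"
  shows "lt (tval M v s) (tval M v t) \<longleftrightarrow> lt (tval M w s) (tval M w t)"
proof -
  obtain ps qs where s: "set ps \<subseteq> insert None (Some ` X)" "set qs \<subseteq> insert None (Some ` X)"
    "length ps \<le> tsize s" "length qs \<le> tsize s"
    "uplus (lift (tval M v s)) (msum v qs) = msum v ps"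
    "uplus (lift (tval M w s)) (msum w qs) = msum w ps"
    using lift_tval[OF assms(1,2)] assms(4) by auto
  obtain ps' qs' where t: "set ps' \<subseteq> insert None (Some ` X)" "set qs' \<subseteq> insert None (Some ` X)"
    "length ps' \<le> tsize t" "length qs' \<le> tsize t"
    "uplus (lift (tval M v t)) (msum v qs') = msum v ps'"
    "uplus (lift (tval M w t)) (msum w qs') = msum w ps'"
    using lift_tval[OF assms(1,3)] assms(4) by auto
  have "uless (msum v (ps @ qs')) (msum v (ps' @ qs)) \<longleftrightarrow> uless (msum w (ps @ qs')) (msum w (ps' @ qs))"
    by (rule agr_less[OF assms(1)]) (use s t assms in auto)
  then show ?thesis
    using U.repr_less_iff[OF s(5) t(5)] U.repr_less_iff[OF s(6) t(6)]
    by (simp add: lift_less_iff)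
qed

lemma agr_atoms:
  assumes "agr N R X v w"
  shows "fvars (Eq s t) \<subseteq> X \<Longrightarrow> tsize s + tsize t \<le> N \<Longrightarrow> sat M v (Eq s t) \<longleftrightarrow> sat M w (Eq s t)"
    and "fvars (Cyc r s t) \<subseteq> X \<Longrightarrow> tsize r + tsize s + tsize t \<le> N \<Longrightarrow>
      sat M v (Cyc r s t) \<longleftrightarrow> sat M w (Cyc r s t)"
proof -
  assume *: "fvars (Eq s t) \<subseteq> X" "tsize s + tsize t \<le> N"
  have "a = b \<longleftrightarrow> \<not> lt a b \<and> \<not> lt b a" for a b using lt_linear[of a b] by auto
  then show "sat M v (Eq s t) \<longleftrightarrow> sat M w (Eq s t)"
    using lt_tval[OF assms, of s t] lt_tval[OF assms, of t s] * by auto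
next
  assume *: "fvars (Cyc r s t) \<subseteq> X" "tsize r + tsize s + tsize t \<le> N"
  then show "sat M v (Cyc r s t) \<longleftrightarrow> sat M w (Cyc r s t)"
    unfolding sat.simps cyc_iff_lt
    using lt_tval[OF assms, of r s] lt_tval[OF assms, of s t] lt_tval[OF assms, of t r] by simp
qed

end

context regular_group
begin

lemma agr_extend:
  assumes "finite X" "0 < N" "0 < R" "agr (2 * fact N * N) (fact N * R) (X - {n}) v w"
  shows "\<exists>b. agr N R X (v(n := a)) (w(n := b))"
proof -
  let ?S = "insert None (Some ` (X - {n}))"
  have "\<exists>b. U.agree N R (insert (Some n) ?S) ((val v)(Some n := lift a)) ((val w)(Some n := b))"
  proof (rule U.agree_extend)
    show "\<forall>k\<in>{1..N}. k dvd fact N" by (auto intro: dvd_fact)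
    show "U.agree (2 * fact N * N) (fact N * R) ?S (val v) (val w)"
      using assms(4) unfolding agr_def .
    show "uless_eq (0, \<zero>) (lift a)" "uless (lift a) (val v None)"
      by (simp_all add: lift_nonneg lift_less_turn)
    show "\<exists>c. uless a (U.nmul n c) \<and> uless (U.nmul n c) b" if "0 < n" "uless a b" for n a b
      using that by (rule cover_dense)
  qed (use assms in auto)
  then obtain b where b: "U.agree N R (insert (Some n) ?S) (val (v(n := a))) ((val w)(Some n := b))"
    unfolding val_upd by blast
  \<comment> \<open>The witness was found in the cover; comparing it with the empty sum and with
    \<open>turn\<close> shows that it is a lift.\<close>
  have "uless (U.lsum (val (v(n := a))) ps) (U.lsum (val (v(n := a))) qs) \<longleftrightarrow>
      uless (U.lsum ((val w)(Some n := b)) ps) (U.lsum ((val w)(Some n := b)) qs)"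
    if "(ps, qs) = ([Some n], []) \<or> (ps, qs) = ([Some n], [None])" for ps qs
    by (rule U.agree_less[OF b]) (use that assms(2) in auto)
  from this[of "[Some n]" "[]"] this[of "[Some n]" "[None]"]
  have "uless_eq (0, \<zero>) b" "uless b turn"
    using lift_nonneg[of a] lift_less_turn[of a] by (auto simp: U.not_less[symmetric])
  then obtain c where "b = lift c" by (rule lift_exhaust)
  then have "U.agree N R (insert (Some n) ?S) (val (v(n := a))) (val (w(n := c)))"
    using b by (simp add: val_upd)
  then have "agr N R X (v(n := a)) (w(n := c))"
    unfolding agr_def by (rule U.agree_mono) auto
  then show ?thesis by blast
qed

end

lemma finite_tvars [simp]: "finite (tvars t)"
  by (induction t) auto

lemma finite_fvars [simp]: "finite (fvars f)"
  by (induction f) auto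

text \<open>\<open>N\<close> and \<open>R\<close> are chosen before the group because the type
  definitions must work in all models at once.\<close>

theorem sat_determined:
  "\<exists>N R. 0 < N \<and> 0 < R \<and>
     (\<forall>(M :: 'a ostruct) v w. regular_group M \<and> oriented_group.agr M N R (fvars f) v w \<longrightarrow>
        (sat M v f \<longleftrightarrow> sat M w f))"
proof (induction f)
  case (Eq s t)
  show ?case
    using oriented_group.agr_atoms(1)[OF regular_group.axioms(1)] tsize_pos[of s]
    by (intro exI[of _ "tsize s + tsize t"] exI[of _ 1]) blast
next
  case (Cyc r s t)
  show ?case
    using oriented_group.agr_atoms(2)[OF regular_group.axioms(1)] tsize_pos[of s]
    by (intro exI[of _ "tsize r + tsize s + tsize t"] exI[of _ 1]) blast
next
  case (Neg f)
  then show ?case by simp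
next
  case (Conj f g)
  then obtain N R N' R' where f: "0 < N" "0 < R"
    "\<And>(M :: 'a ostruct) v w. regular_group M \<Longrightarrow> oriented_group.agr M N R (fvars f) v w \<Longrightarrow>
        (sat M v f \<longleftrightarrow> sat M w f)"
    and g: "0 < N'" "0 < R'"
    "\<And>(M :: 'a ostruct) v w. regular_group M \<Longrightarrow> oriented_group.agr M N' R' (fvars g) v w \<Longrightarrow>
        (sat M v g \<longleftrightarrow> sat M w g)"
    by metis
  have "sat M v (Conj f g) \<longleftrightarrow> sat M w (Conj f g)"
    if M: "regular_group M" and ag: "oriented_group.agr M (max N N') (R * R') (fvars (Conj f g)) v w"
    for M :: "'a ostruct" and v w
  proof -
    interpret regular_group M by (rule M)
    have "agr N R (fvars f) v w" "agr N' R' (fvars g) v w"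
      by (rule agr_mono[OF ag]; simp)+
    then show ?thesis using f(3)[OF M] g(3)[OF M] by auto
  qed
  then show ?case using f g by (intro exI[of _ "max N N'"] exI[of _ "R * R'"]) auto
next
  case (Exi n f)
  then obtain N R where f: "0 < N" "0 < R"
    "\<And>(M :: 'a ostruct) v w. regular_group M \<Longrightarrow> oriented_group.agr M N R (fvars f) v w \<Longrightarrow>
        (sat M v f \<longleftrightarrow> sat M w f)"
    by metis
  let ?N = "2 * fact N * N" and ?R = "fact N * R"
  have step: "sat M w (Exi n f)"
    if M: "regular_group M" and ag: "oriented_group.agr M ?N ?R (fvars (Exi n f)) v w"
      and s: "sat M v (Exi n f)"
    for M :: "'a ostruct" and v w
  proof -
    interpret regular_group M by (rule M)
    obtain a where a: "sat M (v(n := a)) f" using s by auto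
    obtain b where "agr N R (fvars f) (v(n := a)) (w(n := b))"
      using agr_extend[OF finite_fvars f(1,2)] ag by force
    then show ?thesis using a f(3)[OF M] by auto
  qed
  have "sat M v (Exi n f) \<longleftrightarrow> sat M w (Exi n f)"
    if M: "regular_group M" and ag: "oriented_group.agr M ?N ?R (fvars (Exi n f)) v w"
    for M :: "'a ostruct" and v w
    using step[OF M ag] step[OF M oriented_group.agr_sym[OF regular_group.axioms(1)[OF M] ag]] by blast
  moreover have "0 < ?N" "0 < ?R" using f(1,2) by auto
  ultimately show ?case by blast
qed

section \<open>Definability of cuts\<close>

lemma tval_cong: "(\<And>i. i \<in> tvars t \<Longrightarrow> v i = w i) \<Longrightarrow> tval M v t = tval M w t"
  by (induction t) auto

lemma sat_cong: "(\<And>i. i \<in> fvars f \<Longrightarrow> v i = w i) \<Longrightarrow> sat M v f \<longleftrightarrow> sat M w f"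
proof (induction f arbitrary: v w)
  case (Eq s t)
  then have "tval M v s = tval M w s" "tval M v t = tval M w t" by (auto intro!: tval_cong)
  then show ?case by simp
next
  case (Cyc r s t)
  then have "tval M v r = tval M w r" "tval M v s = tval M w s" "tval M v t = tval M w t"
    by (auto intro!: tval_cong)
  then show ?case by simp
next
  case (Neg f)
  have "sat M v f \<longleftrightarrow> sat M w f" by (rule Neg.IH) (use Neg.prems in auto)
  then show ?case by simp
next
  case (Conj f g)
  have "sat M v f \<longleftrightarrow> sat M w f" "sat M v g \<longleftrightarrow> sat M w g"
    by (rule Conj.IH; use Conj.prems in auto)+
  then show ?case by simp
next
  case (Exi n f)
  have "sat M (v(n := a)) f \<longleftrightarrow> sat M (w(n := a)) f" for a
    by (rule Exi.IH) (use Exi.prems in auto)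
  then show ?case by simp
qed

section \<open>Renaming of variables and uniform definability\<close>

primrec rename_term :: "(nat \<Rightarrow> nat) \<Rightarrow> oterm \<Rightarrow> oterm" where
  "rename_term \<rho> (Var n) = Var (\<rho> n)"
| "rename_term \<rho> Zero = Zero"
| "rename_term \<rho> (Add s t) = Add (rename_term \<rho> s) (rename_term \<rho> t)"
| "rename_term \<rho> (Minus t) = Minus (rename_term \<rho> t)"

primrec rename_form :: "(nat \<Rightarrow> nat) \<Rightarrow> oform \<Rightarrow> oform" where
  "rename_form \<rho> (Eq s t) = Eq (rename_term \<rho> s) (rename_term \<rho> t)"
| "rename_form \<rho> (Cyc r s t) = Cyc (rename_term \<rho> r) (rename_term \<rho> s) (rename_term \<rho> t)"
| "rename_form \<rho> (Neg f) = Neg (rename_form \<rho> f)"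
| "rename_form \<rho> (Conj f g) = Conj (rename_form \<rho> f) (rename_form \<rho> g)"
| "rename_form \<rho> (Exi n f) = Exi (\<rho> n) (rename_form \<rho> f)"

lemma tval_rename: "tval M v (rename_term \<rho> t) = tval M (v \<circ> \<rho>) t"
  by (induction t) auto

lemma tvars_rename: "tvars (rename_term \<rho> t) = \<rho> ` tvars t"
  by (induction t) auto

text \<open>Bound variables are renamed as well, so injectivity is what prevents capture.\<close>

lemma sat_rename: "inj \<rho> \<Longrightarrow> sat M v (rename_form \<rho> f) \<longleftrightarrow> sat M (v \<circ> \<rho>) f"
proof (induction f arbitrary: v)
  case (Exi n f)
  have "v(\<rho> n := a) \<circ> \<rho> = (v \<circ> \<rho>)(n := a)" for a
    using Exi.prems by (auto simp: fun_eq_iff inj_eq)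
  then show ?case using Exi by (simp del: fun_upd_apply comp_apply)
qed (simp_all add: tval_rename)

lemma fvars_rename: "inj \<rho> \<Longrightarrow> fvars (rename_form \<rho> f) = \<rho> ` fvars f"
  by (induction f) (auto simp: tvars_rename inj_eq)

text \<open>One formula has to serve all regular groups over the type. Closure properties of this
  notion replace writing out the formulas.\<close>

definition definable :: "nat set \<Rightarrow> ('a ostruct \<Rightarrow> (nat \<Rightarrow> 'a) \<Rightarrow> bool) \<Rightarrow> bool" where
  "definable X P \<longleftrightarrow>
     (\<exists>f. fvars f \<subseteq> X \<and> (\<forall>M v. regular_group M \<longrightarrow> (sat M v f \<longleftrightarrow> P M v)))"

lemma definableI:
  "fvars f \<subseteq> X \<Longrightarrow> (\<And>M v. regular_group M \<Longrightarrow> sat M v f \<longleftrightarrow> P M v) \<Longrightarrow> definable X P"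
  unfolding definable_def by blast

lemma definable_cong:
  assumes "definable X P" "X \<subseteq> Y" "\<And>M v. regular_group M \<Longrightarrow> P M v \<longleftrightarrow> Q M v"
  shows "definable Y Q"
  using assms unfolding definable_def by (metis subset_trans)

lemma definable_const: "definable X (\<lambda>M v. c)"
  by (rule definableI[of "if c then Eq Zero Zero else Neg (Eq Zero Zero)"]) auto

lemma definable_not: "definable X P \<Longrightarrow> definable X (\<lambda>M v. \<not> P M v)"
  unfolding definable_def by (metis fvars.simps(3) sat.simps(3))

lemma definable_conj:
  assumes "definable X P" "definable X Q"
  shows "definable X (\<lambda>M v. P M v \<and> Q M v)"
proof -
  obtain f g where f: "fvars f \<subseteq> X" "\<And>M v. regular_group M \<Longrightarrow> sat M v f \<longleftrightarrow> P M v"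
    and g: "fvars g \<subseteq> X" "\<And>M v. regular_group M \<Longrightarrow> sat M v g \<longleftrightarrow> Q M v"
    using assms unfolding definable_def by blast
  show ?thesis by (rule definableI[of "Conj f g"]) (use f g in auto)
qed

lemma definable_disj:
  assumes "definable X P" "definable X Q"
  shows "definable X (\<lambda>M v. P M v \<or> Q M v)"
  using definable_not[OF definable_conj[OF definable_not definable_not, OF assms]] by simp

lemma definable_ex:
  assumes "definable Y P" "Y \<subseteq> insert n X"
  shows "definable X (\<lambda>M v. \<exists>a. P M (v(n := a)))"
proof -
  obtain f where "fvars f \<subseteq> Y" "\<And>M v. regular_group M \<Longrightarrow> sat M v f \<longleftrightarrow> P M v"
    using assms(1) unfolding definable_def by blast
  then show ?thesis by (intro definableI[of "Exi n f"]) (use assms(2) in auto)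
qed

text \<open>The bounded quantifier is outside the language and unfolds into a finite
  disjunction.\<close>

lemma definable_ex_less:
  assumes "\<And>i. i < n \<Longrightarrow> definable X (P i)"
  shows "definable X (\<lambda>M v. \<exists>i<(n::nat). P i M v)"
  using assms
proof (induction n)
  case 0
  then show ?case using definable_const[of X False] by simp
next
  case (Suc n)
  have "definable X (\<lambda>M v. (\<exists>i<n. P i M v) \<or> P n M v)"
    by (intro definable_disj Suc) (use Suc.prems in auto)
  then show ?case by (rule definable_cong) (auto simp: less_Suc_eq)
qed

lemma definable_rename:
  assumes "definable X P" "inj \<rho>" "\<rho> ` X \<subseteq> Y"
  shows "definable Y (\<lambda>M v. P M (v \<circ> \<rho>))"
proof -
  obtain f where "fvars f \<subseteq> X" "\<And>M v. regular_group M \<Longrightarrow> sat M v f \<longleftrightarrow> P M v"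
    using assms(1) unfolding definable_def by blast
  then show ?thesis
    by (intro definableI[of "rename_form \<rho> f"])
      (use assms(2,3) in \<open>auto 0 3 simp: sat_rename fvars_rename\<close>)
qed

lemma definable_lt:
  assumes "tvars s \<subseteq> X" "tvars t \<subseteq> X"
  shows "definable X (\<lambda>M v. oriented_group.lt M (tval M v s) (tval M v t))"
proof -
  have "definable X (\<lambda>M v. sat M v (Conj (Eq s Zero) (Neg (Eq t Zero))) \<or> sat M v (Cyc Zero s t))"
    by (intro definable_disj definableI[OF _ refl]) (use assms in auto)
  then show ?thesis
    by (rule definable_cong) (auto simp: oriented_group.lt_def[OF regular_group.axioms(1)])
qed

text \<open>\<open>turn\<close> has second component zero, so it contributes \<open>Zero\<close>
  here and is accounted for by \<open>level\<close>.\<close>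

definition index_term :: "nat option \<Rightarrow> oterm" where
  "index_term i = (case i of None \<Rightarrow> Zero | Some n \<Rightarrow> Var n)"

definition sum_term :: "nat option list \<Rightarrow> oterm" where
  "sum_term ps = foldr (\<lambda>i t. Add (index_term i) t) ps Zero"

lemma sum_term_simps [simp]:
  "sum_term [] = Zero" "sum_term (i # ps) = Add (index_term i) (sum_term ps)"
  by (simp_all add: sum_term_def)

lemma tvars_index_term: "tvars (index_term i) \<subseteq> Some -` {i}"
  by (auto simp: index_term_def split: option.splits)

lemma tvars_sum_term: "tvars (sum_term ps) \<subseteq> Some -` set ps"
proof (induction ps)
  case (Cons i ps)
  then show ?case using tvars_index_term[of i] by auto
qed simp

context oriented_group
begin

text \<open>The cover is not part of the language. A bounded sum has only finitely many possible
  integer parts, however, and which one occurs is determined by carries, that is, by comparisons in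
  \<open>A\<close>.\<close>

definition level :: "(nat \<Rightarrow> 'a) \<Rightarrow> nat option list \<Rightarrow> int" where
  "level v ps = fst (msum v ps)"

definition sum_less :: "(nat \<Rightarrow> 'a) \<Rightarrow> nat option list \<Rightarrow> nat option list \<Rightarrow> bool" where
  "sum_less v ps qs \<longleftrightarrow> uless (msum v ps) (msum v qs)"

lemma tval_index_term: "tval M v (index_term i) = snd (val v i)"
  by (auto simp: index_term_def turn_def lift_def split: option.splits)

lemma tval_sum_term: "tval M v (sum_term ps) = snd (msum v ps)"
  by (induction ps) (auto simp: tval_index_term snd_uplus)

lemma level_Nil: "level v [] = 0"
  by (simp add: level_def)

lemma level_Cons: "level v (i # ps) = (if i = None then 1 else 0) + level v ps +
    of_bool (lt (tval M v (Add (index_term i) (sum_term ps))) (tval M v (index_term i)))"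
  by (cases i) (simp_all add: level_def fst_uplus carry_def tval_index_term tval_sum_term,
      simp_all add: turn_def lift_def)

text \<open>Each entry contributes at most one turn of its own and one carry.\<close>

lemma level_bounds: "0 \<le> level v ps \<and> level v ps \<le> 2 * int (length ps)"
  by (induction ps) (auto simp: level_Nil level_Cons)

lemma sum_less_iff: "sum_less v ps qs \<longleftrightarrow> level v ps < level v qs \<or>
    level v ps = level v qs \<and> lt (tval M v (sum_term ps)) (tval M v (sum_term qs))"
  by (simp add: sum_less_def uless_def level_def tval_sum_term)

lemma val_comp: "val (\<lambda>i. v (\<sigma> i)) i = val v (map_option \<sigma> i)"
  by (cases i) auto

lemma msum_comp: "msum (\<lambda>i. v (\<sigma> i)) ps = msum v (map (map_option \<sigma>) ps)"
  by (induction ps) (simp_all add: val_comp)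

end

lemma definable_level:
  "Some -` set ps \<subseteq> X \<Longrightarrow> definable X (\<lambda>M v. oriented_group.level M v ps = int j)"
proof (induction ps arbitrary: j)
  case Nil
  show ?case
    by (rule definable_cong[OF definable_const[of X "j = 0"] subset_refl])
      (auto simp: oriented_group.level_Nil[OF regular_group.axioms(1)])
next
  case (Cons i ps)
  define c :: nat where "c = (if i = None then 1 else 0)"
  define carries where "carries = (\<lambda>(M :: 'a ostruct) v. oriented_group.lt M
    (tval M v (Add (index_term i) (sum_term ps))) (tval M v (index_term i)))"
  have X: "tvars (index_term i) \<subseteq> X" "tvars (sum_term ps) \<subseteq> X"
    using Cons.prems tvars_index_term[of i] tvars_sum_term[of ps] by auto
  then have carries: "definable X carries"
    unfolding carries_def by (intro definable_lt) auto
  \<comment> \<open>The tail never has a greater level than the whole list, so the bound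
    \<open>k < Suc j\<close> loses nothing.\<close>
  have "definable X (\<lambda>M v. \<exists>k<Suc j. oriented_group.level M v ps = int k \<and>
     (j = c + k + 1 \<and> carries M v \<or> j = c + k \<and> \<not> carries M v))"
    by (intro definable_ex_less definable_conj definable_disj definable_not definable_const carries
        Cons.IH) (use Cons.prems in auto)
  then show ?case
  proof (rule definable_cong[OF _ subset_refl])
    fix M :: "'a ostruct" and v assume "regular_group M"
    then interpret oriented_group M by (rule regular_group.axioms)
    obtain k where k: "level v ps = int k" using level_bounds[of v ps] nonneg_int_cases by blast
    have "level v (i # ps) = int c + int k + of_bool (carries M v)"
      unfolding level_Cons k by (simp add: c_def carries_def)
    then show "(\<exists>k<Suc j. level v ps = int k \<and>
       (j = c + k + 1 \<and> carries M v \<or> j = c + k \<and> \<not> carries M v)) \<longleftrightarrow> level v (i # ps) = int j"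
      unfolding k by auto
  qed
qed

lemma definable_sum_less:
  assumes "Some -` set ps \<subseteq> X" "Some -` set qs \<subseteq> X"
  shows "definable X (\<lambda>M v. oriented_group.sum_less M v ps qs)"
proof -
  have X: "tvars (sum_term ps) \<subseteq> X" "tvars (sum_term qs) \<subseteq> X"
    using assms tvars_sum_term[of ps] tvars_sum_term[of qs] by auto
  let ?lt = "\<lambda>(M :: 'a ostruct) v. oriented_group.lt M (tval M v (sum_term ps)) (tval M v (sum_term qs))"
  have "definable X (\<lambda>M v. \<exists>j<Suc (2 * length ps). \<exists>k<Suc (2 * length qs).
      oriented_group.level M v ps = int j \<and> oriented_group.level M v qs = int k \<and>
      (j < k \<or> j = k \<and> ?lt M v))"
    by (intro definable_ex_less definable_conj definable_disj definable_const definable_lt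
        definable_level assms X)
  then show ?thesis
  proof (rule definable_cong[OF _ subset_refl])
    fix M :: "'a ostruct" and v assume "regular_group M"
    then interpret oriented_group M by (rule regular_group.axioms)
    obtain j k where jk: "level v ps = int j" "level v qs = int k"
      using level_bounds[of v] nonneg_int_cases by metis
    then have "j < Suc (2 * length ps)" "k < Suc (2 * length qs)"
      using level_bounds[of v ps] level_bounds[of v qs] by linarith+
    then show "(\<exists>j<Suc (2 * length ps). \<exists>k<Suc (2 * length qs).
      level v ps = int j \<and> level v qs = int k \<and> (j < k \<or> j = k \<and> ?lt M v)) \<longleftrightarrow> sum_less v ps qs"
      unfolding sum_less_iff jk by auto
  qed
qed

section \<open>Largest cuts and germs\<close>

context oriented_group
begin

text \<open>\<open>s\<close> tells whether \<open>L\<close> times the object variable lies on the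
  cut given by \<open>qs\<close> minus \<open>ps\<close> or strictly above it. Equality is spelled
  as two failing comparisons, the form that \<open>definable_sum_less\<close> handles.\<close>

definition admissible :: "nat \<Rightarrow> nat \<Rightarrow> nat option list \<Rightarrow> nat option list \<Rightarrow> bool \<Rightarrow> nat \<Rightarrow>
    (nat \<Rightarrow> 'a) \<Rightarrow> bool" where
  "admissible L R ps qs s r v \<longleftrightarrow>
     (if s then \<not> sum_less v qs (replicate L (Some 0) @ ps) \<and> \<not> sum_less v (replicate L (Some 0) @ ps) qs
      else sum_less v qs (replicate L (Some 0) @ ps)) \<and>
     (\<exists>y. U.nmul R (lift y) = uplus (lift (v 0)) (U.nmul r turn))"

lemma sum_less_comp: "sum_less (\<lambda>i. v (\<sigma> i)) ps qs \<longleftrightarrow>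
    sum_less v (map (map_option \<sigma>) ps) (map (map_option \<sigma>) qs)"
  by (simp add: sum_less_def msum_comp)

lemma admissible_cong:
  assumes "set ps \<subseteq> insert None (Some ` X)" "set qs \<subseteq> insert None (Some ` X)"
    "\<And>i. i \<in> insert 0 X \<Longrightarrow> v i = w i"
  shows "admissible L R ps qs s r v \<longleftrightarrow> admissible L R ps qs s r w"
proof -
  have "msum v ps = msum w ps" "msum v qs = msum w qs"
    by (rule U.lsum_cong; use assms in auto)+
  then show ?thesis using assms(3)[of 0] by (simp add: admissible_def sum_less_def)
qed

end

context regular_group
begin

text \<open>The parameter is one that gives the largest cut below \<open>a\<close>; no cut coming from \<open>B\<close>
  separates \<open>a\<close> from the smaller admissible elements.\<close>

lemma maximal_cut:
  fixes N R m :: nat and B :: "(nat \<Rightarrow> 'a) set"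
  assumes "finite B" "B \<noteq> {}" "0 < N" "0 < R"
  defines "S \<equiv> insert None (Some ` {1..m})" and "L \<equiv> fact N"
  shows "\<exists>u\<in>B. \<exists>ps qs s r. set ps \<subseteq> S \<and> set qs \<subseteq> S \<and> length ps \<le> L * N \<and> length qs \<le> L * N \<and> r < R \<and>
     admissible L R ps qs s r (case_nat a u) \<and>
     (\<forall>w\<in>B. \<forall>b. admissible L R ps qs s r (case_nat b u) \<and> \<not> lt a b \<longrightarrow>
        agr N R {0..m} (case_nat a w) (case_nat b w))"
proof -
  have L: "0 < L" by (simp add: L_def)
  define T where "T = {ps. set ps \<subseteq> S \<and> length ps \<le> L * N}"
  have "finite T" unfolding T_def S_def by (rule finite_lists_length_le) simp
  define cut where "cut u ps qs = udiff (msum (case_nat a u) qs) (msum (case_nat a u) ps)" for u ps qs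
  \<comment> \<open>Lists in \<open>T\<close> avoid the index \<open>Some 0\<close>, so the cuts
    depend on the parameters alone.\<close>
  have cut: "udiff (msum (case_nat b u) qs) (msum (case_nat b u) ps) = cut u ps qs"
    if "ps \<in> T" "qs \<in> T" for b u ps qs
  proof -
    have "msum (case_nat b u) ps = msum (case_nat a u) ps" if "ps \<in> T" for ps
      by (rule U.lsum_cong) (use that in \<open>auto simp: T_def S_def val_def split: nat.splits\<close>)
    then show ?thesis using that by (simp add: cut_def)
  qed
  have less: "uless (uplus (U.nmul L (lift b)) (msum (case_nat b u) ps)) (msum (case_nat b u) qs) \<longleftrightarrow>
      uless (U.nmul L (lift b)) (cut u ps qs)"
    and greater: "uless (msum (case_nat b u) qs) (uplus (U.nmul L (lift b)) (msum (case_nat b u) ps)) \<longleftrightarrow>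
      uless (cut u ps qs) (U.nmul L (lift b))"
    if "ps \<in> T" "qs \<in> T" for b u ps qs
    unfolding cut[OF that, of b u, symmetric] by (simp_all add: U.less_diff_eq U.diff_less_eq)
  define F where "F = {(u, ps, qs) \<in> B \<times> T \<times> T. uless_eq (cut u ps qs) (U.nmul L (lift a))}"
  have "finite F" unfolding F_def
    by (rule finite_subset[of _ "B \<times> T \<times> T"]) (use \<open>finite T\<close> assms(1) in auto)
  moreover obtain u0 where "u0 \<in> B" using assms(2) by blast
  \<comment> \<open>The empty lists give the cut at zero, so at least one cut lies at or below
    \<open>L * a\<close>.\<close>
  have "uless_eq (U.nmul L (0, \<zero>)) (U.nmul L (lift a))"
    using lift_nonneg[of a] U.nmul_less_iff[OF L] by (metis U.not_less)
  then have "(u0, [], []) \<in> F" using \<open>u0 \<in> B\<close> by (simp add: F_def T_def cut_def)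
  then have "F \<noteq> {}" by blast
  ultimately obtain x where x: "x \<in> F"
    "\<forall>y\<in>F. uless_eq (cut (fst y) (fst (snd y)) (snd (snd y))) (cut (fst x) (fst (snd x)) (snd (snd x)))"
    using U.finite_ex_max[of F "\<lambda>y. cut (fst y) (fst (snd y)) (snd (snd y))"] by blast
  obtain u ps qs where xs: "x = (u, ps, qs)" by (cases x)
  have u: "u \<in> B" "ps \<in> T" "qs \<in> T" "uless_eq (cut u ps qs) (U.nmul L (lift a))"
    using x(1) by (auto simp: F_def xs)
  have max: "uless_eq (cut w ps' qs') (cut u ps qs)"
    if "w \<in> B" "ps' \<in> T" "qs' \<in> T" "uless_eq (cut w ps' qs') (U.nmul L (lift a))" for w ps' qs'
    using x(2)[rule_format, of "(w, ps', qs')"] that by (simp add: F_def xs)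
  define s where "s \<longleftrightarrow> cut u ps qs = U.nmul L (lift a)"
  obtain r where r: "r < R" "\<exists>y. U.nmul R (lift y) = uplus (lift a) (U.nmul r turn)"
    using residue_exists[OF assms(4)] by blast
  have sum: "sum_less (case_nat b u) qs (replicate L (Some 0) @ ps) \<longleftrightarrow> uless (cut u ps qs) (U.nmul L (lift b))"
    "sum_less (case_nat b u) (replicate L (Some 0) @ ps) qs \<longleftrightarrow> uless (U.nmul L (lift b)) (cut u ps qs)"
    for b
    using less[OF u(2,3)] greater[OF u(2,3)] by (simp_all add: sum_less_def)
  have adm: "admissible L R ps qs s r (case_nat b u) \<longleftrightarrow>
      (if s then U.nmul L (lift b) = cut u ps qs else uless (cut u ps qs) (U.nmul L (lift b))) \<and>
      (\<exists>y. U.nmul R (lift y) = uplus (lift b) (U.nmul r turn))" for b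
    unfolding admissible_def sum using U.less_linear[of "U.nmul L (lift b)" "cut u ps qs"] by auto
  have "admissible L R ps qs s r (case_nat a u)"
    unfolding adm using r(2) u(4) by (simp add: s_def U.less_le)
  moreover have "agr N R {0..m} (case_nat a w) (case_nat b w)"
    if w: "w \<in> B" and b: "admissible L R ps qs s r (case_nat b u)" "\<not> lt a b" for w b
  proof -
    have same: "uless (U.nmul L (lift a)) (cut w ps' qs') \<longleftrightarrow> uless (U.nmul L (lift b)) (cut w ps' qs')"
      "uless (cut w ps' qs') (U.nmul L (lift a)) \<longleftrightarrow> uless (cut w ps' qs') (U.nmul L (lift b))"
      if T: "ps' \<in> T" "qs' \<in> T" for ps' qs'
    proof -
      have ba: "uless_eq (U.nmul L (lift b)) (U.nmul L (lift a))"
        using b(2) U.nmul_less_iff[OF L] by (metis U.not_less lift_less_iff)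
      show "uless (U.nmul L (lift a)) (cut w ps' qs') \<longleftrightarrow> uless (U.nmul L (lift b)) (cut w ps' qs')"
        "uless (cut w ps' qs') (U.nmul L (lift a)) \<longleftrightarrow> uless (cut w ps' qs') (U.nmul L (lift b))"
      \<comment> \<open>On the cut, \<open>L * b = L * a\<close>. Strictly above it, a cut at or
        below \<open>L * a\<close> is at most the maximal one and hence below \<open>L * b\<close>,
        while a cut above \<open>L * a\<close> is also above \<open>L * b\<close>, since
        \<open>b\<close> is not above \<open>a\<close>.\<close>
      proof (atomize (full), cases s)
        case True
        then have "U.nmul L (lift b) = U.nmul L (lift a)" using b(1) unfolding adm by (simp add: s_def)
        then show "(uless (U.nmul L (lift a)) (cut w ps' qs') \<longleftrightarrow> uless (U.nmul L (lift b)) (cut w ps' qs')) \<and>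
          (uless (cut w ps' qs') (U.nmul L (lift a)) \<longleftrightarrow> uless (cut w ps' qs') (U.nmul L (lift b)))"
          by simp
      next
        case False
        then have lo: "uless (cut u ps qs) (U.nmul L (lift b))" using b(1) unfolding adm by simp
        show "(uless (U.nmul L (lift a)) (cut w ps' qs') \<longleftrightarrow> uless (U.nmul L (lift b)) (cut w ps' qs')) \<and>
          (uless (cut w ps' qs') (U.nmul L (lift a)) \<longleftrightarrow> uless (cut w ps' qs') (U.nmul L (lift b)))"
        proof (cases "uless_eq (cut w ps' qs') (U.nmul L (lift a))")
          case True
          from U.le_less_trans[OF max[OF w T True] lo]
          have "uless (cut w ps' qs') (U.nmul L (lift b))" .
          moreover from U.less_le_trans[OF this ba] have "uless (cut w ps' qs') (U.nmul L (lift a))" .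
          ultimately show ?thesis by (meson U.less_asym)
        next
          case False
          then have "uless (U.nmul L (lift a)) (cut w ps' qs')" by (simp add: U.not_le)
          moreover from U.le_less_trans[OF ba this] have "uless (U.nmul L (lift b)) (cut w ps' qs')" .
          ultimately show ?thesis by (meson U.less_asym)
        qed
      qed
    qed
    obtain y y' where y: "U.nmul R (lift y) = uplus (lift a) (U.nmul r turn)"
      "U.nmul R (lift y') = uplus (lift b) (U.nmul r turn)"
      using r(2) b(1) unfolding adm by blast
    \<comment> \<open>Both lifts become multiples of \<open>R\<close> after adding the same
      \<open>r\<close> turns, so they differ by a multiple of \<open>R\<close>.\<close>
    have "lift b = uplus (lift a) (U.nmul R (udiff (lift y') (lift y)))"
      unfolding U.nmul_diff y U.add_diff_cancel_right
      by (simp add: U.add.commute[of "lift a"])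
    moreover have "U.agree N R S (val (case_nat a w)) (val (case_nat b w))"
    proof -
      have eq: "val (case_nat b w) i = val (case_nat a w) i" if "i \<in> S" for i
        using that by (auto simp: S_def val_def split: nat.splits)
      then have "msum (case_nat b w) ps' = msum (case_nat a w) ps'" if "set ps' \<subseteq> S" for ps'
        by (intro U.lsum_cong) (use that in blast)
      moreover have "\<exists>c. val (case_nat b w) i = uplus (val (case_nat a w) i) (U.nmul R c)" if "i \<in> S" for i
        by (rule exI[of _ "(0, \<zero>)"]) (simp add: eq[OF that])
      ultimately show ?thesis unfolding U.agree_def by simp
    qed
    ultimately have "U.agree N R (insert (Some 0) S) (val (case_nat a w)) (val (case_nat b w))"
    proof (intro U.agree_insertI[of N L])
      show "\<forall>k\<in>{1..N}. k dvd L" unfolding L_def by (auto intro: dvd_fact)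
    next
      fix ps' qs' assume "set ps' \<subseteq> S" "set qs' \<subseteq> S" "length ps' \<le> L * N" "length qs' \<le> L * N"
      then have T: "ps' \<in> T" "qs' \<in> T" by (simp_all add: T_def)
      have val0: "val (case_nat x w) (Some 0) = lift x" for x by simp
      show "uless (uplus (U.nmul L (val (case_nat a w) (Some 0))) (msum (case_nat a w) ps')) (msum (case_nat a w) qs')
        \<longleftrightarrow> uless (uplus (U.nmul L (val (case_nat b w) (Some 0))) (msum (case_nat b w) ps')) (msum (case_nat b w) qs')"
        unfolding val0 less[OF T] by (rule same(1)[OF T])
      show "uless (msum (case_nat a w) qs') (uplus (U.nmul L (val (case_nat a w) (Some 0))) (msum (case_nat a w) ps'))
        \<longleftrightarrow> uless (msum (case_nat b w) qs') (uplus (U.nmul L (val (case_nat b w) (Some 0))) (msum (case_nat b w) ps'))"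
        unfolding val0 greater[OF T] by (rule same(2)[OF T])
    qed (use L in simp_all)
    moreover have "insert (Some 0) S = insert None (Some ` {0..m})"
      by (auto simp: S_def image_iff)
    ultimately show ?thesis by (simp add: agr_def)
  qed
  ultimately show ?thesis using u r(1) unfolding T_def by blast
qed

end

lemma definable_admissible:
  assumes "set ps \<subseteq> insert None (Some ` {1..m})" "set qs \<subseteq> insert None (Some ` {1..m})"
  shows "definable ({m..<2 * m} \<union> {n})
    (\<lambda>M v. oriented_group.admissible M L R ps qs s r (\<lambda>i. v (case_nat n (\<lambda>j. m + j) i)))"
proof -
  let ?X = "{m..<2 * m} \<union> {n}"
  define \<sigma> where "\<sigma> = case_nat n (\<lambda>j. m + j)"
  \<comment> \<open>\<open>k\<close> only has to differ from \<open>n\<close>: the residue condition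
    mentions no parameter, so a clash with the parameter block is harmless.\<close>
  define k where "k = Suc n"
  let ?low = "map (map_option \<sigma>) qs" and ?high = "map (map_option \<sigma>) (replicate L (Some 0) @ ps)"
  have \<sigma>: "\<sigma> i \<in> ?X" if "i \<in> {0..m}" for i
    using that by (cases i) (auto simp: \<sigma>_def)
  have X: "Some -` set ?low \<subseteq> ?X" "Some -` set ?high \<subseteq> ?X"
    using assms \<sigma> by (fastforce simp: map_option_case split: option.splits if_splits)+
  have cmp: "definable ?X (\<lambda>M v. oriented_group.sum_less M v ?low ?high)"
    "definable ?X (\<lambda>M v. oriented_group.sum_less M v ?high ?low)"
    using definable_sum_less[OF X] definable_sum_less[OF X(2,1)] by blast+
  let ?l = "replicate R (Some k)" and ?r = "Some n # replicate r None"
  have "definable (insert k ?X) (\<lambda>M v. \<not> oriented_group.sum_less M v ?l ?r \<and> \<not> oriented_group.sum_less M v ?r ?l)"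
    by (intro definable_conj definable_not definable_sum_less) (auto split: if_splits)
  then have "definable ?X (\<lambda>M v. \<exists>y. \<not> oriented_group.sum_less M (v(k := y)) ?l ?r \<and>
      \<not> oriented_group.sum_less M (v(k := y)) ?r ?l)"
    by (rule definable_ex) simp
  then have "definable ?X (\<lambda>M v.
      (s \<and> \<not> oriented_group.sum_less M v ?low ?high \<and> \<not> oriented_group.sum_less M v ?high ?low \<or>
       \<not> s \<and> oriented_group.sum_less M v ?low ?high) \<and>
      (\<exists>y. \<not> oriented_group.sum_less M (v(k := y)) ?l ?r \<and> \<not> oriented_group.sum_less M (v(k := y)) ?r ?l))"
    by (intro definable_conj definable_disj definable_const definable_not cmp)
  then show ?thesis
  proof (rule definable_cong[OF _ subset_refl])
    fix M :: "'a ostruct" and v assume "regular_group M"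
    then interpret oriented_group M by (rule regular_group.axioms)
    have eq: "\<not> uless x y \<and> \<not> uless y x \<longleftrightarrow> x = y" for x y
      using U.less_linear[of x y] by auto
    have "\<not> sum_less (v(k := y)) ?l ?r \<and> \<not> sum_less (v(k := y)) ?r ?l \<longleftrightarrow>
        U.nmul R (lift y) = uplus (lift (v n)) (U.nmul r turn)" for y
      unfolding sum_less_def eq by (simp add: k_def)
    then show "(s \<and> \<not> sum_less v ?low ?high \<and> \<not> sum_less v ?high ?low \<or> \<not> s \<and> sum_less v ?low ?high) \<and>
      (\<exists>y. \<not> sum_less (v(k := y)) ?l ?r \<and> \<not> sum_less (v(k := y)) ?r ?l) \<longleftrightarrow>
      admissible L R ps qs s r (\<lambda>i. v (case_nat n (\<lambda>j. m + j) i))"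
      unfolding admissible_def \<sigma>_def[symmetric] sum_less_comp by (simp add: \<sigma>_def)
  qed
qed

text \<open>In \<open>germ\<close>, the variables \<open>0, \<dots>, m - 1\<close> of \<open>v\<close> are the block \<open>y\<close> and \<open>m, \<dots>, 2m - 1\<close> the block
  \<open>y\<^sub>1\<close> of the type definition, whereas \<open>admissible\<close> and the formula have the object variable at \<open>0\<close>.\<close>

definition germ :: "'a ostruct \<Rightarrow> nat \<Rightarrow> nat \<Rightarrow> nat \<Rightarrow> nat option list \<times> nat option list \<times> bool \<times> nat \<Rightarrow>
    oform \<Rightarrow> (nat \<Rightarrow> 'a) \<Rightarrow> bool" where
  "germ M m L R idx f v \<longleftrightarrow> (case idx of (ps, qs, s, r) \<Rightarrow>
     \<exists>a. oriented_group.admissible M L R ps qs s r (case_nat a (\<lambda>j. v (m + j))) \<and>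
       (\<forall>b. oriented_group.admissible M L R ps qs s r (case_nat b (\<lambda>j. v (m + j))) \<and>
          \<not> oriented_group.lt M a b \<longrightarrow> sat M (case_nat b v) f))"

lemma definable_germ:
  assumes "set ps \<subseteq> insert None (Some ` {1..m})" "set qs \<subseteq> insert None (Some ` {1..m})"
    and "fvars f \<subseteq> {..<1 + m}"
  shows "definable {..<2 * m} (\<lambda>M v. germ M m L R (ps, qs, s, r) f v)"
proof -
  let ?x = "2 * m" and ?y = "2 * m + 1"
  \<comment> \<open>Parameters of \<open>f\<close> go to the first block and its object variable to
    \<open>?y\<close>; all other indices are moved beyond \<open>?y\<close> to keep the map
    injective.\<close>
  define \<rho> where "\<rho> i = (case i of 0 \<Rightarrow> ?y | Suc j \<Rightarrow> if j < m then j else j + 2 * m + 2)" for i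
  have "inj \<rho>"
    by (auto simp: inj_def \<rho>_def split: nat.splits if_splits)
  let ?adm = "\<lambda>n M v. oriented_group.admissible M L R ps qs s r (\<lambda>i. v (case_nat n (\<lambda>j. m + j) i))"
  have adm: "definable {..<2 * m + 2} (?adm ?x)" "definable {..<2 * m + 2} (?adm ?y)"
    by (rule definable_cong[OF definable_admissible[OF assms(1,2)]]; auto)+
  have "definable {..<1 + m} (\<lambda>M v. sat M v f)"
    using assms(3) by (rule definableI) simp
  then have "definable {..<2 * m + 2} (\<lambda>M v. sat M (v \<circ> \<rho>) f)"
    by (rule definable_rename[OF _ \<open>inj \<rho>\<close>]) (auto simp: \<rho>_def split: nat.splits)
  moreover have "definable {..<2 * m + 2} (\<lambda>M v. oriented_group.lt M (v ?x) (v ?y))"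
    using definable_lt[of "Var ?x" "{..<2 * m + 2}" "Var ?y"] by simp
  ultimately have "definable {..<2 * m + 2} (\<lambda>M v. ?adm ?y M v \<and> \<not> oriented_group.lt M (v ?x) (v ?y) \<and>
      \<not> sat M (v \<circ> \<rho>) f)"
    by (intro definable_conj definable_not adm)
  then have "definable (insert ?x {..<2 * m}) (\<lambda>M v. \<exists>b. ?adm ?y M (v(?y := b)) \<and>
      \<not> oriented_group.lt M ((v(?y := b)) ?x) ((v(?y := b)) ?y) \<and> \<not> sat M (v(?y := b) \<circ> \<rho>) f)"
    by (rule definable_ex) auto
  moreover have "definable (insert ?x {..<2 * m}) (?adm ?x)"
    by (rule definable_cong[OF definable_admissible[OF assms(1,2)]]) auto
  ultimately have "definable (insert ?x {..<2 * m}) (\<lambda>M v. ?adm ?x M v \<and> \<not> (\<exists>b. ?adm ?y M (v(?y := b)) \<and>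
      \<not> oriented_group.lt M ((v(?y := b)) ?x) ((v(?y := b)) ?y) \<and> \<not> sat M (v(?y := b) \<circ> \<rho>) f))"
    by (intro definable_conj definable_not)
  then have "definable {..<2 * m} (\<lambda>M v. \<exists>a. ?adm ?x M (v(?x := a)) \<and>
      \<not> (\<exists>b. ?adm ?y M (v(?x := a, ?y := b)) \<and>
      \<not> oriented_group.lt M ((v(?x := a, ?y := b)) ?x) ((v(?x := a, ?y := b)) ?y) \<and>
      \<not> sat M (v(?x := a, ?y := b) \<circ> \<rho>) f))"
    by (rule definable_ex) simp
  then show ?thesis
  proof (rule definable_cong[OF _ subset_refl])
    fix M :: "'a ostruct" and v assume "regular_group M"
    then interpret oriented_group M by (rule regular_group.axioms)
    have x: "?adm ?x M (v(?x := a)) \<longleftrightarrow> admissible L R ps qs s r (case_nat a (\<lambda>j. v (m + j)))" for a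
      by (rule admissible_cong[OF assms(1,2)]) (auto split: nat.splits)
    have y: "?adm ?y M (v(?x := a, ?y := b)) \<longleftrightarrow> admissible L R ps qs s r (case_nat b (\<lambda>j. v (m + j)))" for a b
      by (rule admissible_cong[OF assms(1,2)]) (auto split: nat.splits)
    have f: "sat M (v(?x := a, ?y := b) \<circ> \<rho>) f \<longleftrightarrow> sat M (case_nat b v) f" for a b
      by (rule sat_cong) (use assms(3) in \<open>auto simp: \<rho>_def split: nat.splits\<close>)
    show "(\<exists>a. ?adm ?x M (v(?x := a)) \<and> \<not> (\<exists>b. ?adm ?y M (v(?x := a, ?y := b)) \<and>
      \<not> lt ((v(?x := a, ?y := b)) ?x) ((v(?x := a, ?y := b)) ?y) \<and>
      \<not> sat M (v(?x := a, ?y := b) \<circ> \<rho>) f)) \<longleftrightarrow> germ M m L R (ps, qs, s, r) f v"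
      unfolding x y f germ_def by auto
  qed
qed

lemma sat_determined_finite:
  assumes "finite \<Delta>"
  shows "\<exists>N R. 0 < N \<and> 0 < R \<and> (\<forall>f\<in>\<Delta>. \<forall>(M :: 'a ostruct) v w.
     regular_group M \<and> oriented_group.agr M N R (fvars f) v w \<longrightarrow> (sat M v f \<longleftrightarrow> sat M w f))"
  using assms
proof (induction \<Delta>)
  case empty
  show ?case by auto
next
  case (insert g \<Delta>)
  obtain N R where D: "0 < N" "0 < R" "\<And>f (M :: 'a ostruct) v w. f \<in> \<Delta> \<Longrightarrow> regular_group M \<Longrightarrow>
     oriented_group.agr M N R (fvars f) v w \<Longrightarrow> (sat M v f \<longleftrightarrow> sat M w f)"
    using insert.IH by metis
  obtain N' R' where g: "0 < N'" "0 < R'" "\<And>(M :: 'a ostruct) v w. regular_group M \<Longrightarrow>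
     oriented_group.agr M N' R' (fvars g) v w \<Longrightarrow> (sat M v g \<longleftrightarrow> sat M w g)"
    using sat_determined[of g] by metis
  have "sat M v f \<longleftrightarrow> sat M w f"
    if f: "f \<in> insert g \<Delta>" and M: "regular_group M"
      and ag: "oriented_group.agr M (max N N') (R * R') (fvars f) v w"
    for f and M :: "'a ostruct" and v w
  proof -
    interpret regular_group M by (rule M)
    have "agr N R (fvars f) v w" "agr N' R' (fvars f) v w"
      by (rule agr_mono[OF ag]; simp)+
    then show ?thesis using D(3)[OF _ M] g(3)[OF M] f by auto
  qed
  moreover have "0 < max N N'" "0 < R * R'" using D g by auto
  ultimately show ?case by blast
qed

theorem regular_groups_UDTFS:
  fixes K :: "'a ostruct set"
  assumes K: "\<And>M. M \<in> K \<Longrightarrow> (\<exists>a. a \<noteq> ozero M) \<Longrightarrow> regular_group M"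
    and \<Delta>: "finite \<Delta>" "\<And>f. f \<in> \<Delta> \<Longrightarrow> partitioned m f"
  shows "has_UDTFS K m 1 \<Delta>"
proof -
  obtain N R where NR: "0 < N" "0 < R" and det: "\<And>f (M :: 'a ostruct) v w. f \<in> \<Delta> \<Longrightarrow> regular_group M \<Longrightarrow>
     oriented_group.agr M N R (fvars f) v w \<Longrightarrow> (sat M v f \<longleftrightarrow> sat M w f)"
    using sat_determined_finite[OF \<Delta>(1)] by metis
  define L :: nat where "L = fact N"
  define T where "T = {ps. set ps \<subseteq> insert None (Some ` {1..m}) \<and> length ps \<le> L * N}"
  define Idx where "Idx = T \<times> T \<times> (UNIV :: bool set) \<times> {..<R}"
  have "finite T" unfolding T_def by (rule finite_lists_length_le) simp
  then have "finite Idx" by (simp add: Idx_def)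
  \<comment> \<open>\<open>has_UDTFS\<close> takes natural numbers as indices, so the tuples of cut
    data are numbered.\<close>
  then obtain h and n :: nat where h: "Idx = h ` {i. i < n}"
    using finite_imp_nat_seg_image_inj_on by metis
  have "\<forall>i f. \<exists>g. i < n \<and> f \<in> \<Delta> \<longrightarrow> fvars g \<subseteq> {..<2 * m} \<and>
    (\<forall>(M :: 'a ostruct) v. regular_group M \<longrightarrow> (sat M v g \<longleftrightarrow> germ M m L R (h i) f v))"
  proof (intro allI)
    fix i f
    show "\<exists>g. i < n \<and> f \<in> \<Delta> \<longrightarrow> fvars g \<subseteq> {..<2 * m} \<and>
      (\<forall>(M :: 'a ostruct) v. regular_group M \<longrightarrow> (sat M v g \<longleftrightarrow> germ M m L R (h i) f v))"
    proof (cases "i < n \<and> f \<in> \<Delta>")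
      case True
      then have "h i \<in> Idx" unfolding h by blast
      then obtain ps qs s r where i: "h i = (ps, qs, s, r)" "ps \<in> T" "qs \<in> T"
        by (auto simp: Idx_def)
      have "definable {..<2 * m} (\<lambda>(M :: 'a ostruct) v. germ M m L R (h i) f v)"
        unfolding i(1)
        by (rule definable_germ) (use i True \<Delta>(2) in \<open>auto simp: T_def partitioned_def\<close>)
      then show ?thesis unfolding definable_def by blast
    qed blast
  qed
  then obtain \<psi> where "\<forall>i f. i < n \<and> f \<in> \<Delta> \<longrightarrow> fvars (\<psi> i f) \<subseteq> {..<2 * m} \<and>
    (\<forall>(M :: 'a ostruct) v. regular_group M \<longrightarrow> (sat M v (\<psi> i f) \<longleftrightarrow> germ M m L R (h i) f v))"
    by metis
  then have \<psi>: "\<And>i f. i < n \<Longrightarrow> f \<in> \<Delta> \<Longrightarrow> fvars (\<psi> i f) \<subseteq> {..<2 * m}"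
    "\<And>i f (M :: 'a ostruct) v. i < n \<Longrightarrow> f \<in> \<Delta> \<Longrightarrow> regular_group M \<Longrightarrow>
      sat M v (\<psi> i f) \<longleftrightarrow> germ M m L R (h i) f v"
    by blast+
  have "defines_types M m 1 \<Delta> {i. i < n} \<psi>" if "M \<in> K" for M
    unfolding defines_types_def
  proof (intro allI impI, elim conjE)
    fix B q
    assume B: "finite B" "\<forall>b\<in>B. length b = m" "2 \<le> card B" and q: "complete_type M \<Delta> B q"
    \<comment> \<open>Two distinct tuples of equal length require two elements. This excludes the
      one-element group, which is a model when all torsion exponents are 0 but not a
      \<open>regular_group\<close>.\<close>
    have "\<exists>a. a \<noteq> ozero M"
    proof (rule ccontr)
      assume "\<nexists>a. a \<noteq> ozero M"
      then have "x = y" for x y :: 'a by metis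
      then have "b = c" if "b \<in> B" "c \<in> B" for b c
        using B(2) that by (intro nth_equalityI) auto
      then have "card B \<le> 1" using B(1) by (simp add: card_le_Suc0_iff_eq)
      then show False using B(3) by simp
    qed
    then have M: "regular_group M" using K that by blast
    interpret regular_group M by (rule M)
    \<comment> \<open>Since \<open>q\<close> is finite, finite satisfiability realizes all of it by
      a single \<open>a\<close>.\<close>
    have "finite q"
      using q B(1) \<Delta>(1) unfolding complete_type_def by (meson finite_SigmaI finite_UNIV finite_subset)
    then obtain a where a: "\<forall>(f, b, s)\<in>q. sat_list M f (a # b) \<longleftrightarrow> s"
      using q unfolding complete_type_def by blast
    have in_q: "(f, b, True) \<in> q \<longleftrightarrow> sat M (case_nat a ((!) b)) f" if "f \<in> \<Delta>" "b \<in> B" for f b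
    proof -
      have "(!) (a # b) = case_nat a ((!) b)" by (auto simp: fun_eq_iff nth_Cons)
      moreover have "(f, b, True) \<in> q \<or> (f, b, False) \<in> q"
        using q that unfolding complete_type_def by blast
      ultimately show ?thesis using a unfolding sat_list_def by auto
    qed
    have "finite ((!) ` B)" "(!) ` B \<noteq> {}" using B(1,3) by auto
    from maximal_cut[OF this NR, of m a, folded L_def]
    obtain c ps qs s r where c: "c \<in> B" and idx: "(ps, qs, s, r) \<in> Idx"
      and adm: "admissible L R ps qs s r (case_nat a ((!) c))"
      and agr: "\<And>b x. b \<in> B \<Longrightarrow> admissible L R ps qs s r (case_nat x ((!) c)) \<Longrightarrow> \<not> lt a x \<Longrightarrow>
        agr N R {0..m} (case_nat a ((!) b)) (case_nat x ((!) b))"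
      unfolding Idx_def T_def by auto
    obtain i where i: "i < n" "h i = (ps, qs, s, r)" using idx unfolding h by force
    have "(f, b, True) \<in> q \<longleftrightarrow> sat_list M (\<psi> i f) (b @ concat [c])" if fb: "f \<in> \<Delta>" "b \<in> B" for f b
    proof -
      have fv: "fvars f \<subseteq> {0..m}" using \<Delta>(2)[OF fb(1)] by (auto simp: partitioned_def)
      have same: "sat M (case_nat a ((!) b)) f \<longleftrightarrow> sat M (case_nat x ((!) b)) f"
        if "admissible L R ps qs s r (case_nat x ((!) c))" "\<not> lt a x" for x
        by (rule det[OF fb(1) M], rule agr_mono[OF agr[OF fb(2) that] order_refl dvd_refl fv])
      have env: "sat M (case_nat x ((!) (b @ c))) f \<longleftrightarrow> sat M (case_nat x ((!) b)) f" for x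
        by (rule sat_cong) (use fv B(2) fb(2) in \<open>auto simp: nth_append split: nat.splits\<close>)
      have "(\<lambda>j. (b @ c) ! (m + j)) = (!) c" using B(2) fb(2) by (auto simp: nth_append fun_eq_iff)
      then have "sat_list M (\<psi> i f) (b @ concat [c]) \<longleftrightarrow>
        (\<exists>x. admissible L R ps qs s r (case_nat x ((!) c)) \<and>
          (\<forall>y. admissible L R ps qs s r (case_nat y ((!) c)) \<and> \<not> lt x y \<longrightarrow> sat M (case_nat y ((!) b)) f))"
        unfolding sat_list_def using \<psi>(2)[OF i(1) fb(1) M] by (simp add: germ_def i(2) env)
      \<comment> \<open>The truth value of \<open>f\<close> is constant on the admissible elements
        up to \<open>a\<close>. A bound \<open>x\<close> below \<open>a\<close> is one of them; a
        bound \<open>x\<close> at or above \<open>a\<close> has \<open>a\<close> in its own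
        range.\<close>
      also have "\<dots> \<longleftrightarrow> sat M (case_nat a ((!) b)) f"
      proof
        assume "\<exists>x. admissible L R ps qs s r (case_nat x ((!) c)) \<and>
          (\<forall>y. admissible L R ps qs s r (case_nat y ((!) c)) \<and> \<not> lt x y \<longrightarrow> sat M (case_nat y ((!) b)) f)"
        then obtain x where x: "admissible L R ps qs s r (case_nat x ((!) c))"
          "\<And>y. admissible L R ps qs s r (case_nat y ((!) c)) \<Longrightarrow> \<not> lt x y \<Longrightarrow> sat M (case_nat y ((!) b)) f"
          by blast
        show "sat M (case_nat a ((!) b)) f"
        proof (cases "lt x a")
          case True
          then show ?thesis using same[OF x(1) lt_asym] x(2)[OF x(1) lt_irrefl] by blast
        qed (rule x(2)[OF adm])
      qed (use adm same in blast)
      also have "\<dots> \<longleftrightarrow> (f, b, True) \<in> q" using in_q[OF fb] by simp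
      finally show ?thesis by simp
    qed
    then show "\<exists>bs i. length bs = 1 \<and> set bs \<subseteq> B \<and> i \<in> {i. i < n} \<and>
      (\<forall>f\<in>\<Delta>. \<forall>b\<in>B. (f, b, True) \<in> q \<longleftrightarrow> sat_list M (\<psi> i f) (b @ concat bs))"
      using c i(1) by (intro exI[of _ "[c]"] exI[of _ i]) auto
  qed
  then show ?thesis
    unfolding has_UDTFS_def using \<psi>(1)
    by (intro exI[of _ "{i. i < n}"] exI[of _ \<psi>]) (auto simp: mult_2)
qed

theorem theorem3p4:
  fixes e :: "nat \<Rightarrow> enat"
  assumes "e \<in> {\<lambda>_. 0, \<lambda>_. \<infinity>}"
  shows "has_VC_property (T_models (\<lambda>_. 0) e :: 'a ostruct set) 1"
  unfolding has_VC_property_def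
proof (intro allI impI)
  fix m \<Delta>
  assume "finite \<Delta> \<and> (\<forall>f\<in>\<Delta>. partitioned m f)"
  then show "has_UDTFS (T_models (\<lambda>_. 0) e :: 'a ostruct set) m 1 \<Delta>"
    by (intro regular_groups_UDTFS)
      (auto simp: T_models_def intro!: regular_group.intro oriented_group.intro regular_group_axioms.intro)
qed

end
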